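(* Let $\Delta$ be a thick building of purely infinite type (not necessarily of finite rank), with set of chambers $\mathcal{C}$ and gallery metric $d$, and let $G$ be a group of automorphisms of $\Delta$ (a subgroup of $\operatorname{Aut}(\Delta)$). If there is a bounded (with respect to $d$) set of representatives for the $G$-orbits in $\mathcal{C}$, then $G$ has trivial center.
   Context: A building $\Delta$ with Weyl group $(W,S)$, where $(W,S)$ is a Coxeter system ($S$ possibly infinite) with length function $l$, is described by a nonempty set $\mathcal{C}$ of chambers and a Weyl distance function $\delta\colon\mathcal{C}\times\mathcal{C}\to W$ such that for all $C,D\in\mathcal{C}$: (1) $\delta(C,D)=1$ iff $C=D$; (2) if $\delta(C,D)=w$ and $C'\in\mathcal{C}$ satisfies $\delta(C',C)=s\in S$, then $\delta(C',D)\in\{sw,w\}$, and if moreover $l(sw)=l(w)+1$ then $\delta(C',D)=sw$; (3) if $\delta(C,D)=w$, then for every $s\in S$ there is $C'\in\mathcal{C}$ with $\delta(C',C)=s$ and $\delta(C',D)=sw$. Chambers $C,D$ are $s$-adjacent if $\delta(C,D)=s$. The building is thick if for every chamber $C$ and every $s\in S$ there are at least two chambers $s$-adjacent to $C$. The gallery metric is $d(C,D)=l(\delta(C,D))$. An automorphism $\phi$ of $\Delta$ (not necessarily type-preserving) is a bijection $\phi\colon\mathcal{C}\to\mathcal{C}$ for which there is an automorphism $\sigma$ of $(W,S)$ (a group automorphism of $W$ with $\sigma(S)=S$) such that $\delta(\phi(C),\phi(D))=\sigma(\delta(C,D))$ for all $C,D\in\mathcal{C}$. The group of all automorphisms is $\operatorname{Aut}(\Delta)$.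 $\Delta$ is of purely infinite type if every irreducible factor of its Weyl group $(W,S)$ is infinite; the irreducible factors are the Coxeter systems $(\langle S_i\rangle,S_i)$, where the $S_i$ are the vertex sets of the connected components of the Coxeter diagram of $(W,S)$. *)

theory Defs
  imports
    "HOL-Algebra.Generated_Groups"
    "HOL-Algebra.Multiplicative_Group"
    "HOL-Algebra.Group_Action"
begin

section \<open>Coxeter systems\<close>

definition word_prod :: "('w, 'm) monoid_scheme \<Rightarrow> 'w list \<Rightarrow> 'w" where
  "word_prod W ws = foldr (\<lambda>x y. x \<otimes>\<^bsub>W\<^esub> y) ws \<one>\<^bsub>W\<^esub>"

text \<open>
  Deletion of one relator \<open>(s t)\<^bsup>m(s,t)\<^esup>\<close>, where \<open>m(s,t)\<close> is the order of \<open>s t\<close> in \<open>W\<close>.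
  Since \<^const>\<open>group.ord\<close> is \<open>0\<close> for elements of infinite order, the relator is then the empty
  word, i.e. no relation is imposed. For \<open>s = t\<close> the relator is \<open>s s\<close>.
\<close>

inductive coxeter_step :: "('w, 'm) monoid_scheme \<Rightarrow> 'w set \<Rightarrow> 'w list \<Rightarrow> 'w list \<Rightarrow> bool"
  for W S where
  "s \<in> S \<Longrightarrow> t \<in> S \<Longrightarrow>
     coxeter_step W S (u @ concat (replicate (group.ord W (s \<otimes>\<^bsub>W\<^esub> t)) [s, t]) @ v) (u @ v)"

text \<open>
  \<open>W\<close> has the presentation \<open>\<langle>S | (s t)\<^bsup>m(s,t)\<^esup> = 1\<rangle>\<close>. As the relators include \<open>s s\<close>, every element
  of the presented group is represented by a word in \<open>S\<close> without formal inverses, and two such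
  words represent the same element iff they are connected by insertions and deletions of relators.
\<close>

locale coxeter_system = group W for W (structure) +
  fixes S
  assumes gens_closed: "S \<subseteq> carrier W"
    and gens_generate: "generate W S = carrier W"
    and gens_order: "s \<in> S \<Longrightarrow> ord s = 2"
    and presentation: "\<lbrakk>us \<in> lists S; vs \<in> lists S; word_prod W us = word_prod W vs\<rbrakk>
      \<Longrightarrow> equivclp (coxeter_step W S) us vs"

definition cox_length :: "('w, 'm) monoid_scheme \<Rightarrow> 'w set \<Rightarrow> 'w \<Rightarrow> nat" where
  "cox_length W S w = (LEAST n. \<exists>ws \<in> lists S. length ws = n \<and> word_prod W ws = w)"

definition cox_automorphisms :: "('w, 'm) monoid_scheme \<Rightarrow> 'w set \<Rightarrow> ('w \<Rightarrow> 'w) set" where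
  "cox_automorphisms W S = {\<sigma> \<in> iso W W. \<sigma> ` S = S}"

text \<open>Order \<open>0\<close> stands for the label \<open>\<infinity>\<close>.\<close>

definition diagram_edge :: "('w, 'm) monoid_scheme \<Rightarrow> 'w set \<Rightarrow> 'w \<Rightarrow> 'w \<Rightarrow> bool" where
  "diagram_edge W S s t \<longleftrightarrow> s \<in> S \<and> t \<in> S \<and> s \<noteq> t \<and>
     (group.ord W (s \<otimes>\<^bsub>W\<^esub> t) = 0 \<or> group.ord W (s \<otimes>\<^bsub>W\<^esub> t) \<ge> 3)"

definition diagram_components :: "('w, 'm) monoid_scheme \<Rightarrow> 'w set \<Rightarrow> 'w set set" where
  "diagram_components W S = S // {(s, t). s \<in> S \<and> t \<in> S \<and> (diagram_edge W S)\<^sup>*\<^sup>* s t}"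

definition purely_infinite :: "('w, 'm) monoid_scheme \<Rightarrow> 'w set \<Rightarrow> bool" where
  "purely_infinite W S \<longleftrightarrow> (\<forall>T \<in> diagram_components W S. infinite (generate W T))"


section \<open>Buildings\<close>

locale building = coxeter_system W S for W (structure) and S +
  fixes Ch :: "'c set" and \<delta> :: "'c \<Rightarrow> 'c \<Rightarrow> 'a"
  assumes chambers_nonempty: "Ch \<noteq> {}"
    and dist_closed: "\<lbrakk>C \<in> Ch; D \<in> Ch\<rbrakk> \<Longrightarrow> \<delta> C D \<in> carrier W"
    and dist_one: "\<lbrakk>C \<in> Ch; D \<in> Ch\<rbrakk> \<Longrightarrow> \<delta> C D = \<one> \<longleftrightarrow> C = D"
    and dist_adjacent: "\<lbrakk>C \<in> Ch; D \<in> Ch; C' \<in> Ch; s \<in> S; \<delta> C' C = s\<rbrakk>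
      \<Longrightarrow> \<delta> C' D \<in> {s \<otimes> \<delta> C D, \<delta> C D}"
    and dist_adjacent_up: "\<lbrakk>C \<in> Ch; D \<in> Ch; C' \<in> Ch; s \<in> S; \<delta> C' C = s;
        cox_length W S (s \<otimes> \<delta> C D) = cox_length W S (\<delta> C D) + 1\<rbrakk>
      \<Longrightarrow> \<delta> C' D = s \<otimes> \<delta> C D"
    and dist_exists: "\<lbrakk>C \<in> Ch; D \<in> Ch; s \<in> S\<rbrakk>
      \<Longrightarrow> \<exists>C' \<in> Ch. \<delta> C' C = s \<and> \<delta> C' D = s \<otimes> \<delta> C D"

definition thick :: "'w set \<Rightarrow> 'c set \<Rightarrow> ('c \<Rightarrow> 'c \<Rightarrow> 'w) \<Rightarrow> bool" where
  "thick S Ch \<delta> \<longleftrightarrow>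
     (\<forall>C \<in> Ch. \<forall>s \<in> S. \<exists>D \<in> Ch. \<exists>E \<in> Ch. D \<noteq> E \<and> \<delta> C D = s \<and> \<delta> C E = s)"

definition gallery_dist ::
  "('w, 'm) monoid_scheme \<Rightarrow> 'w set \<Rightarrow> ('c \<Rightarrow> 'c \<Rightarrow> 'w) \<Rightarrow> 'c \<Rightarrow> 'c \<Rightarrow> nat" where
  "gallery_dist W S \<delta> C D = cox_length W S (\<delta> C D)"

text \<open>As for \<^const>\<open>BijGroup\<close>, automorphisms are taken to be extensional functions on \<open>Ch\<close>.\<close>

definition building_automorphisms ::
  "('w, 'm) monoid_scheme \<Rightarrow> 'w set \<Rightarrow> 'c set \<Rightarrow> ('c \<Rightarrow> 'c \<Rightarrow> 'w) \<Rightarrow> ('c \<Rightarrow> 'c) set" where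
  "building_automorphisms W S Ch \<delta> = {\<phi> \<in> Bij Ch. \<exists>\<sigma> \<in> cox_automorphisms W S.
     \<forall>C \<in> Ch. \<forall>D \<in> Ch. \<delta> (\<phi> C) (\<phi> D) = \<sigma> (\<delta> C D)}"

definition building_Aut ::
  "('w, 'm) monoid_scheme \<Rightarrow> 'w set \<Rightarrow> 'c set \<Rightarrow> ('c \<Rightarrow> 'c \<Rightarrow> 'w) \<Rightarrow> ('c \<Rightarrow> 'c) monoid" where
  "building_Aut W S Ch \<delta> = BijGroup Ch \<lparr>carrier := building_automorphisms W S Ch \<delta>\<rparr>"

lemma (in building) subgroup_building_automorphisms:
  "subgroup (building_automorphisms W S Ch \<delta>) (BijGroup Ch)"
proof (rule group.subgroupI[OF group_BijGroup])
  show "building_automorphisms W S Ch \<delta> \<subseteq> carrier (BijGroup Ch)"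
    by (auto simp: building_automorphisms_def BijGroup_def)
next
  have "(\<lambda>x\<in>Ch. x) \<in> building_automorphisms W S Ch \<delta>"
    unfolding building_automorphisms_def cox_automorphisms_def
    using id_Bij[of Ch] by (auto intro!: bexI[of _ "\<lambda>x. x"] simp: iso_def hom_def bij_betw_def)
  then show "building_automorphisms W S Ch \<delta> \<noteq> {}" by blast
next
  fix f assume f: "f \<in> building_automorphisms W S Ch \<delta>"
  then obtain \<sigma> where fB: "f \<in> Bij Ch" and \<sigma>: "\<sigma> \<in> iso W W" "\<sigma> ` S = S"
    and eq: "\<And>C D. C \<in> Ch \<Longrightarrow> D \<in> Ch \<Longrightarrow> \<delta> (f C) (f D) = \<sigma> (\<delta> C D)"
    by (auto simp: building_automorphisms_def cox_automorphisms_def)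
  let ?\<tau> = "inv_into (carrier W) \<sigma>" and ?g = "inv_into Ch f"
  have inj: "inj_on \<sigma> (carrier W)" using \<sigma> by (auto simp: iso_def bij_betw_def)
  have "?\<tau> \<in> iso W W" using \<sigma>(1) by (rule iso_set_sym)
  moreover have "?\<tau> ` S = S"
    using inv_into_image_cancel[OF inj gens_closed] \<sigma>(2) by simp
  moreover have "\<delta> (?g C) (?g D) = ?\<tau> (\<delta> C D)" if "C \<in> Ch" "D \<in> Ch" for C D
  proof -
    have im: "f ` Ch = Ch" using fB by (auto simp: Bij_def bij_betw_def)
    have CD: "?g C \<in> Ch" "?g D \<in> Ch" "f (?g C) = C" "f (?g D) = D"
      using that im by (auto intro: inv_into_into f_inv_into_f)
    have "\<delta> C D = \<sigma> (\<delta> (?g C) (?g D))" using eq[OF CD(1,2)] CD by simp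
    then show ?thesis using inv_into_f_f[OF inj dist_closed[OF CD(1,2)]] by simp
  qed
  ultimately show "inv\<^bsub>BijGroup Ch\<^esub> f \<in> building_automorphisms W S Ch \<delta>"
    unfolding building_automorphisms_def cox_automorphisms_def inv_BijGroup[OF fB]
    using restrict_inv_into_Bij[OF fB] by (auto intro!: bexI[of _ ?\<tau>])
next
  fix f g
  assume "f \<in> building_automorphisms W S Ch \<delta>" "g \<in> building_automorphisms W S Ch \<delta>"
  then obtain \<sigma> \<tau> where fB: "f \<in> Bij Ch" and gB: "g \<in> Bij Ch"
    and \<sigma>: "\<sigma> \<in> iso W W" "\<sigma> ` S = S" and \<tau>: "\<tau> \<in> iso W W" "\<tau> ` S = S"
    and eqf: "\<And>C D. C \<in> Ch \<Longrightarrow> D \<in> Ch \<Longrightarrow> \<delta> (f C) (f D) = \<sigma> (\<delta> C D)"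
    and eqg: "\<And>C D. C \<in> Ch \<Longrightarrow> D \<in> Ch \<Longrightarrow> \<delta> (g C) (g D) = \<tau> (\<delta> C D)"
    by (auto simp: building_automorphisms_def cox_automorphisms_def)
  have "\<sigma> \<circ> \<tau> \<in> iso W W" using \<sigma>(1) \<tau>(1) by (metis iso_set_trans)
  moreover have "(\<sigma> \<circ> \<tau>) ` S = S" using \<sigma>(2) \<tau>(2) by (simp only: image_comp[symmetric])
  moreover have "g C \<in> Ch" if "C \<in> Ch" for C
    using Bij_imp_funcset[OF gB] that by auto
  ultimately show "f \<otimes>\<^bsub>BijGroup Ch\<^esub> g \<in> building_automorphisms W S Ch \<delta>"
    unfolding building_automorphisms_def cox_automorphisms_def
    using compose_Bij[OF fB gB] fB gB
    by (auto intro!: exI[of _ "\<sigma> \<circ> \<tau>"] simp: BijGroup_def compose_def eqf eqg)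
qed

lemma (in building) group_building_Aut: "group (building_Aut W S Ch \<delta>)"
  unfolding building_Aut_def
  using subgroup.subgroup_is_group[OF subgroup_building_automorphisms group_BijGroup] .


section \<open>Centre and orbit representatives\<close>

definition center :: "('g, 'm) monoid_scheme \<Rightarrow> 'g set" where
  "center G = {z \<in> carrier G. \<forall>g \<in> carrier G. z \<otimes>\<^bsub>G\<^esub> g = g \<otimes>\<^bsub>G\<^esub> z}"

definition orbit_representatives ::
  "('x \<Rightarrow> 'x, 'm) monoid_scheme \<Rightarrow> 'x set \<Rightarrow> 'x set \<Rightarrow> bool" where
  "orbit_representatives G X R \<longleftrightarrow>
     R \<subseteq> X \<and> (\<forall>Ob \<in> orbits G X (\<lambda>g. g). \<exists>!r. r \<in> R \<and> r \<in> Ob)"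

end

theory Submission
  imports Defs "HOL-Library.Sublist"
begin

text \<open>
  A central element \<open>z\<close> of \<open>G\<close> moves all chambers of a \<open>G\<close>-orbit equally far, so its displacement
  is bounded, and it suffices that a nontrivial automorphism \<open>\<phi>\<close> has unbounded displacement.
  Otherwise choose \<open>C\<close> with \<open>w = \<delta>(C, \<phi> C) \<noteq> 1\<close> of maximal length. Moving \<open>C\<close> inside its panels,
  thickness forces \<open>s w = w \<sigma>(s)\<close> for every \<open>s\<close> in the set \<open>K\<close> of generators with
  \<open>l(s w) > l(w)\<close>. Hence the Demazure product of any \<open>x\<close> with \<open>w\<close> lies in \<open>W\<^sub>K w\<close>;
  as it also has the form \<open>x v\<close> with \<open>v\<close> a subword of a fixed reduced word of \<open>w\<close>, the subgroup
  \<open>W\<^sub>K\<close> has finite index. Its normal core avoids each \<open>t \<notin> K\<close>, hence also all neighbours of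
  such a \<open>t\<close> in the diagram, hence the whole component of \<open>t\<close>; this component therefore embeds
  into a finite group of permutations of cosets, contrary to pure infiniteness.
\<close>

section \<open>Words, lengths and the exchange condition\<close>

context coxeter_system
begin

abbreviation len :: "'a \<Rightarrow> nat" where "len \<equiv> cox_length W S"
abbreviation wprod :: "'a list \<Rightarrow> 'a" where "wprod \<equiv> word_prod W"

section \<open>Words in the generators and their lengths\<close>

lemma gen_carrier [simp]: "s \<in> S \<Longrightarrow> s \<in> carrier W"
  using gens_closed by auto

lemma wprod_simps [simp]: "wprod [] = \<one>" "wprod (s # ws) = s \<otimes> wprod ws"
  by (auto simp: word_prod_def)

lemma wprod_closed [simp]: "ws \<in> lists (carrier W) \<Longrightarrow> wprod ws \<in> carrier W"
  by (induction ws) auto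

lemma wprod_closed_set [simp]: "\<forall>x\<in>set ws. x \<in> carrier W \<Longrightarrow> wprod ws \<in> carrier W"
  by (rule wprod_closed) auto

lemma wprod_gens_closed [simp]: "\<forall>x\<in>set ws. x \<in> S \<Longrightarrow> wprod ws \<in> carrier W"
  by (rule wprod_closed_set) auto

lemma lists_gens_carrier [simp]: "ws \<in> lists S \<Longrightarrow> ws \<in> lists (carrier W)"
  using gens_closed by auto

lemma wprod_append:
  "us \<in> lists (carrier W) \<Longrightarrow> vs \<in> lists (carrier W) \<Longrightarrow> wprod (us @ vs) = wprod us \<otimes> wprod vs"
  by (induction us) (auto simp: m_assoc)

lemma gen_square: "s \<in> S \<Longrightarrow> s \<otimes> s = \<one>"
  using pow_ord_eq_1[of s] gens_order[of s] by (simp add: numeral_2_eq_2)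

lemma inv_gen: "s \<in> S \<Longrightarrow> inv s = s"
  by (simp add: gen_square inv_equality)

lemma gen_neq_one: "s \<in> S \<Longrightarrow> s \<noteq> \<one>"
  using gens_order[of s] ord_eq_1[of "\<one>"] by auto

lemma gen_cancel: "s \<in> S \<Longrightarrow> w \<in> carrier W \<Longrightarrow> s \<otimes> (s \<otimes> w) = w"
  by (simp add: m_assoc[symmetric] gen_square)

lemma gen_cancel_right: "s \<in> S \<Longrightarrow> w \<in> carrier W \<Longrightarrow> w \<otimes> s \<otimes> s = w"
  by (simp add: m_assoc gen_square)

lemma inv_wprod: "ws \<in> lists S \<Longrightarrow> inv (wprod ws) = wprod (rev ws)"
  by (induction ws) (auto simp: wprod_append inv_mult_group inv_gen in_listsI)

text \<open>Generators are involutions, so words without formal inverses already exhaust the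
  subgroup.\<close>

lemma generate_words:
  assumes "K \<subseteq> S"
  shows "generate W K = wprod ` lists K"
proof
  show "generate W K \<subseteq> wprod ` lists K"
  proof
    fix x assume "x \<in> generate W K"
    then show "x \<in> wprod ` lists K"
    proof (induction rule: generate.induct)
      case one
      show ?case by (rule image_eqI[of _ _ "[]"]) auto
    next
      case (incl h)
      then show ?case using assms by (intro image_eqI[of _ _ "[h]"]) auto
    next
      case (inv h)
      then show ?case using assms by (intro image_eqI[of _ _ "[h]"]) (auto simp: inv_gen)
    next
      case (eng h1 h2)
      then obtain us vs where "us \<in> lists K" "vs \<in> lists K" "h1 = wprod us" "h2 = wprod vs" by auto
      moreover from this have "us \<in> lists S" "vs \<in> lists S" using assms by auto
      ultimately show ?case by (intro image_eqI[of _ _ "us @ vs"]) (auto simp: wprod_append)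
    qed
  qed
  show "wprod ` lists K \<subseteq> generate W K"
  proof
    fix x assume "x \<in> wprod ` lists K"
    then obtain ws where "ws \<in> lists K" "x = wprod ws" by auto
    then show "x \<in> generate W K"
      by (induction ws arbitrary: x) (auto intro: generate.intros)
  qed
qed

lemma carrier_words: "w \<in> carrier W \<Longrightarrow> \<exists>ws \<in> lists S. wprod ws = w"
  using generate_words[of S] gens_generate by (metis imageE order_refl)

lemma len_wprod_le: "ws \<in> lists S \<Longrightarrow> len (wprod ws) \<le> length ws"
  unfolding cox_length_def by (rule Least_le) blast

definition reduced :: "'a list \<Rightarrow> bool" where
  "reduced ws \<longleftrightarrow> ws \<in> lists S \<and> len (wprod ws) = length ws"

lemma reduced_in_lists: "reduced ws \<Longrightarrow> ws \<in> lists S"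
  by (simp add: reduced_def)

lemma reduced_word_exists: "w \<in> carrier W \<Longrightarrow> \<exists>ws. reduced ws \<and> wprod ws = w"
proof -
  assume "w \<in> carrier W"
  then have "\<exists>n. \<exists>ws \<in> lists S. length ws = n \<and> wprod ws = w" using carrier_words by blast
  from LeastI_ex[OF this] show ?thesis unfolding reduced_def cox_length_def by metis
qed

lemma len_mult_le:
  assumes "v \<in> carrier W" "w \<in> carrier W"
  shows "len (v \<otimes> w) \<le> len v + len w"
proof -
  obtain us vs where "reduced us" "wprod us = v" "reduced vs" "wprod vs = w"
    using assms reduced_word_exists by meson
  then show ?thesis
    using len_wprod_le[of "us @ vs"] by (auto simp: reduced_def wprod_append)
qed

lemma len_one [simp]: "len \<one> = 0"
  using len_wprod_le[of "[]"] by simp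

lemma len_eq_0: "w \<in> carrier W \<Longrightarrow> len w = 0 \<longleftrightarrow> w = \<one>"
  using reduced_word_exists[of w] by (auto simp: reduced_def)

lemma len_gen: "s \<in> S \<Longrightarrow> len s = 1"
  using len_wprod_le[of "[s]"] len_eq_0[of s] gen_neq_one[of s] by simp

lemma len_inv_le: "w \<in> carrier W \<Longrightarrow> len (inv w) \<le> len w"
proof -
  assume "w \<in> carrier W"
  then obtain ws where "reduced ws" "wprod ws = w" using reduced_word_exists by blast
  then show ?thesis
    using len_wprod_le[of "rev ws"] by (auto simp: reduced_def inv_wprod[symmetric] in_lists_conv_set)
qed

lemma len_inv: "w \<in> carrier W \<Longrightarrow> len (inv w) = len w"
  using len_inv_le[of w] len_inv_le[of "inv w"] by simp

section \<open>Walls along a word and their parity\<close>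

text \<open>The walls crossed by the gallery of type \<open>ws\<close> that starts at the identity.\<close>

fun refls :: "'a list \<Rightarrow> 'a list" where
  "refls [] = []"
| "refls (s # ws) = s # map (\<lambda>t. s \<otimes> t \<otimes> inv s) (refls ws)"

lemma refls_carrier: "ws \<in> lists (carrier W) \<Longrightarrow> refls ws \<in> lists (carrier W)"
  by (induction ws) auto

text \<open>The gallery of type \<open>vs\<close> now begins at \<open>wprod us\<close>, so its
  walls are translated by that element, that is, conjugated.\<close>

lemma refls_append:
  assumes "us \<in> lists (carrier W)" "vs \<in> lists (carrier W)"
  shows "refls (us @ vs) = refls us @ map (\<lambda>t. wprod us \<otimes> t \<otimes> inv (wprod us)) (refls vs)"
  using assms(1)
proof (induction us)
  case Nil
  have "map (\<lambda>t. \<one> \<otimes> t \<otimes> inv \<one>) (refls vs) = refls vs"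
    using refls_carrier[OF assms(2)] by (intro map_idI) auto
  then show ?case by simp
next
  case (Cons u us)
  then show ?case
    using refls_carrier[OF assms(2)] by (auto simp: m_assoc inv_mult_group)
qed

lemma set_refls:
  assumes "ws \<in> lists (carrier W)" "t \<in> set (refls ws)"
  shows "\<exists>us s vs. ws = us @ s # vs \<and> t = wprod us \<otimes> s \<otimes> inv (wprod us)"
  using assms
proof (induction ws arbitrary: t rule: list.induct)
  case Nil
  then show ?case by simp
next
  case (Cons a ws)
  show ?case
  proof (cases "t = a")
    case True
    have "a \<in> carrier W" using Cons.prems(1) by simp
    then show ?thesis using True by (intro exI[of _ "[]"] exI[of _ a] exI[of _ ws]) simp
  next
    case False
    then obtain t' where t': "t' \<in> set (refls ws)" "t = a \<otimes> t' \<otimes> inv a" using Cons.prems by auto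
    from Cons.IH[OF _ this(1)] Cons.prems obtain us s vs
      where "ws = us @ s # vs" "t' = wprod us \<otimes> s \<otimes> inv (wprod us)" by auto
    then show ?thesis using Cons.prems t'
      by (intro exI[of _ "a # us"] exI[of _ s] exI[of _ vs]) (auto simp: m_assoc inv_mult_group)
  qed
qed

text \<open>A wall is a letter conjugated by the prefix in front of it; multiplying by it makes that
  letter meet itself and cancel.\<close>

lemma refl_deletes_letter:
  assumes "ws \<in> lists S" "t \<in> set (refls ws)"
  shows "\<exists>us s vs. ws = us @ s # vs \<and> t \<otimes> wprod ws = wprod (us @ vs)"
proof -
  obtain us s vs where eq: "ws = us @ s # vs" "t = wprod us \<otimes> s \<otimes> inv (wprod us)"
    using set_refls[of ws t] assms by auto
  have c: "us \<in> lists (carrier W)" "vs \<in> lists (carrier W)" "s \<in> S" "s \<in> carrier W"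
    using assms(1) eq(1) lists_gens_carrier by auto
  have "t \<otimes> wprod ws = wprod us \<otimes> (s \<otimes> (inv (wprod us) \<otimes> (wprod us \<otimes> (s \<otimes> wprod vs))))"
    using c by (simp add: eq wprod_append m_assoc)
  also have "\<dots> = wprod us \<otimes> (s \<otimes> (s \<otimes> wprod vs))"
    using c by (simp add: m_assoc[symmetric])
  also have "\<dots> = wprod (us @ vs)"
    using c by (simp add: gen_cancel wprod_append)
  finally show ?thesis using eq(1) by blast
qed

text \<open>Conjugation by \<open>r = s t\<close> turns \<open>r^i s\<close> into
  \<open>r^(i+2) s\<close>, so a further pair \<open>[s, t]\<close> in front shifts the list by two
  and supplies its first two entries.\<close>

lemma refls_relator:
  assumes "s \<in> S" "t \<in> S"
  shows "refls (concat (replicate m [s, t])) = map (\<lambda>i. (s \<otimes> t) [^] i \<otimes> s) [0..<2 * m]"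
proof (induction m)
  case 0
  then show ?case by simp
next
  case (Suc m)
  let ?r = "s \<otimes> t" and ?rel = "concat (replicate m [s, t])"
  have r: "?r \<in> carrier W" using assms by simp
  have rel: "?rel \<in> lists (carrier W)" using assms by (induction m) auto
  have "refls ([s, t] @ ?rel) = [s, s \<otimes> t \<otimes> inv s] @ map (\<lambda>x. ?r \<otimes> x \<otimes> inv ?r) (refls ?rel)"
    using assms rel by (subst refls_append) auto
  also have "map (\<lambda>x. ?r \<otimes> x \<otimes> inv ?r) (refls ?rel)
      = map (\<lambda>i. ?r [^] i \<otimes> s) (map (\<lambda>i. Suc (Suc i)) [0..<2 * m])"
  proof -
    have "?r \<otimes> (?r [^] i \<otimes> s) \<otimes> inv ?r = ?r [^] Suc (Suc i) \<otimes> s" for i :: nat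
    proof -
      have "inv ?r = t \<otimes> s" using assms by (simp add: inv_mult_group inv_gen)
      then have "?r \<otimes> (?r [^] i \<otimes> s) \<otimes> inv ?r = (?r \<otimes> ?r [^] i) \<otimes> ?r \<otimes> s"
        using assms by (simp add: m_assoc)
      also have "?r \<otimes> ?r [^] i = ?r [^] Suc i" using r by (metis nat_pow_Suc2)
      finally show ?thesis by simp
    qed
    then show ?thesis by (simp add: Suc)
  qed
  also have "map (\<lambda>i. Suc (Suc i)) [0..<2 * m] = [2..<2 * Suc m]"
    using map_add_upt[of 2 "2 * m"] by (simp add: numeral_2_eq_2)
  also have "[s, s \<otimes> t \<otimes> inv s] = map (\<lambda>i. ?r [^] i \<otimes> s) [0..<2]"
    using assms by (simp add: numeral_2_eq_2 inv_gen)
  also have "map (\<lambda>i. ?r [^] i \<otimes> s) [0..<2] @ map (\<lambda>i. ?r [^] i \<otimes> s) [2..<2 * Suc m]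
      = map (\<lambda>i. ?r [^] i \<otimes> s) ([0..<2] @ [2..<2 * Suc m])" by simp
  also have "[0..<2] @ [2..<2 * Suc m] = [0..<2 * Suc m]"
    using upt_add_eq_append[of 0 2 "2 * m"] by simp
  finally show ?case by simp
qed

text \<open>Going once round a rank two residue crosses each wall twice, because exponents of
  \<open>s t\<close> matter only modulo its order. For infinite order the relator and
  \<open>L\<close> are empty.\<close>

lemma refls_relator_double:
  assumes "s \<in> S" "t \<in> S"
  shows "\<exists>L. refls (concat (replicate (ord (s \<otimes> t)) [s, t])) = L @ L"
proof -
  let ?r = "s \<otimes> t" and ?m = "ord (s \<otimes> t)"
  have r: "?r \<in> carrier W" using assms by simp
  have "[0..<2 * ?m] = [0..<?m] @ map (\<lambda>i. ?m + i) [0..<?m]"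
    using upt_add_eq_append[of 0 ?m ?m] map_add_upt[of ?m ?m] by (simp add: mult_2 add.commute)
  moreover have "?r [^] (?m + i) = ?r [^] i" for i
    using r by (simp add: nat_pow_mult[symmetric] pow_ord_eq_1)
  ultimately show ?thesis using refls_relator[OF assms] by (auto simp: comp_def)
qed

lemma wprod_relator:
  assumes "s \<in> S" "t \<in> S"
  shows "wprod (concat (replicate m [s, t])) = (s \<otimes> t) [^] m"
proof (induction m)
  case (Suc m)
  have "(s \<otimes> t) [^] Suc m = (s \<otimes> t) \<otimes> (s \<otimes> t) [^] m"
    using assms by (metis gen_carrier m_closed nat_pow_Suc2)
  then show ?case using assms Suc by (simp add: m_assoc)
qed simp

text \<open>A relator has even length and contributes each wall an even number of times. Its product
  is \<open>\<one>\<close>, so the walls of the letters behind it stay in place.\<close>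

lemma coxeter_step_invariants:
  assumes "coxeter_step W S us vs"
  shows "us \<in> lists S \<longleftrightarrow> vs \<in> lists S"
    and "even (length us) \<longleftrightarrow> even (length vs)"
    and "us \<in> lists S \<Longrightarrow> even (count_list (refls us) x) \<longleftrightarrow> even (count_list (refls vs) x)"
  using assms
proof (induction rule: coxeter_step.induct)
  case (1 s t u v)
  let ?rel = "concat (replicate (ord (s \<otimes> t)) [s, t])"
  have rel: "?rel \<in> lists S" using 1 by (auto split: if_splits)
  { case 1 show ?case using rel by auto }
  { case 2 show ?case by (simp add: length_concat sum_list_replicate) }
  { case 3
    then have c: "u \<in> lists (carrier W)" "v \<in> lists (carrier W)" "?rel \<in> lists (carrier W)"
      using rel lists_gens_carrier by auto
    obtain L where L: "refls ?rel = L @ L" using refls_relator_double[OF 1] by blast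
    have "wprod ?rel = \<one>" using wprod_relator[OF 1] 1 by (simp add: pow_ord_eq_1)
    then have "refls (u @ ?rel @ v) = refls u @ map (\<lambda>t. wprod u \<otimes> t \<otimes> inv (wprod u)) (L @ L)
        @ map (\<lambda>t. wprod u \<otimes> t \<otimes> inv (wprod u)) (refls v)"
      using c refls_append[of u "?rel @ v"] refls_append[of ?rel v] L refls_carrier[OF c(2)]
      by (auto simp: map_idI)
    then show ?case using refls_append[OF c(1,2)] by simp blast }
qed

text \<open>The only appeal to \<open>presentation\<close>: parities preserved by single deletions
  depend only on the group element.\<close>

lemma equal_words_invariants:
  assumes "us \<in> lists S" "vs \<in> lists S" "wprod us = wprod vs"
  shows "even (length us) \<longleftrightarrow> even (length vs)"
    and "even (count_list (refls us) x) \<longleftrightarrow> even (count_list (refls vs) x)"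
proof -
  have "equivclp (coxeter_step W S) us vs" using presentation assms by blast
  then have "vs \<in> lists S \<and> (even (length us) \<longleftrightarrow> even (length vs)) \<and>
      (even (count_list (refls us) x) \<longleftrightarrow> even (count_list (refls vs) x))"
  proof (induction rule: equivclp_induct)
    case base
    then show ?case using assms by simp
  next
    case (step y z)
    then show ?case using coxeter_step_invariants[of y z] coxeter_step_invariants[of z y] by blast
  qed
  then show "even (length us) \<longleftrightarrow> even (length vs)"
    "even (count_list (refls us) x) \<longleftrightarrow> even (count_list (refls vs) x)" by auto
qed

text \<open>Parity of word length rules out equality, and subadditivity rules out jumps larger than
  one.\<close>

lemma len_gen_mult_cases:
  assumes "s \<in> S" "w \<in> carrier W"
  shows "len (s \<otimes> w) = len w + 1 \<or> len w = len (s \<otimes> w) + 1"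
proof -
  obtain us where us: "reduced us" "wprod us = w" using reduced_word_exists assms by meson
  obtain vs where vs: "reduced vs" "wprod vs = s \<otimes> w"
    using reduced_word_exists[of "s \<otimes> w"] assms by auto
  have "even (length (s # us)) \<longleftrightarrow> even (length vs)"
    using us vs assms by (intro equal_words_invariants) (auto simp: reduced_def)
  then have "len (s \<otimes> w) \<noteq> len w" using us vs by (auto simp: reduced_def)
  moreover have "len (s \<otimes> w) \<le> len w + 1"
    using len_mult_le[of s w] len_gen assms by simp
  moreover have "len w \<le> len (s \<otimes> w) + 1"
    using len_mult_le[of s "s \<otimes> w"] len_gen assms by (simp add: gen_cancel)
  ultimately show ?thesis by linarith
qed

lemma inv_mult_gen: "s \<in> S \<Longrightarrow> w \<in> carrier W \<Longrightarrow> inv (w \<otimes> s) = s \<otimes> inv w"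
  by (simp add: inv_mult_group inv_gen)

lemma len_mult_gen_cases:
  assumes "s \<in> S" "w \<in> carrier W"
  shows "len (w \<otimes> s) = len w + 1 \<or> len w = len (w \<otimes> s) + 1"
  using len_gen_mult_cases[of s "inv w"] len_inv[of "w \<otimes> s"] len_inv[of w] assms
  by (simp add: inv_mult_gen)

section \<open>Reduced words and the exchange condition\<close>

lemma reduced_ConsD:
  assumes "reduced (s # ws)"
  shows "reduced ws" "len (s \<otimes> wprod ws) = len (wprod ws) + 1"
proof -
  have c: "s \<in> S" "ws \<in> lists S" using assms by (auto simp: reduced_def)
  have "Suc (length ws) \<le> len (wprod ws) + 1"
    using assms len_mult_le[of s "wprod ws"] c by (simp add: reduced_def len_gen)
  then show "reduced ws" "len (s \<otimes> wprod ws) = len (wprod ws) + 1"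
    using assms len_wprod_le[of ws] c by (auto simp: reduced_def)
qed

text \<open>A minimal gallery crosses no wall twice: if the first wall \<open>s\<close> recurred,
  \<open>refl_deletes_letter\<close> would make \<open>s \<otimes> wprod ws\<close> shorter than
  \<open>ws\<close>.\<close>

lemma distinct_refls: "reduced ws \<Longrightarrow> distinct (refls ws)"
proof (induction ws)
  case Nil
  then show ?case by simp
next
  case (Cons s ws)
  have c: "s \<in> S" "ws \<in> lists S" using Cons.prems by (auto simp: reduced_def)
  have rc: "set (refls ws) \<subseteq> carrier W" using refls_carrier[of ws] c by auto
  have inj: "inj_on (\<lambda>t. s \<otimes> t \<otimes> inv s) (carrier W)"
    using c by (auto simp: inj_on_def)
  have "s \<notin> set (refls ws)"
  proof
    assume "s \<in> set (refls ws)"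
    then obtain us r vs where eq: "ws = us @ r # vs" "s \<otimes> wprod ws = wprod (us @ vs)"
      using refl_deletes_letter c by blast
    then have "len (s \<otimes> wprod ws) < length ws"
      using len_wprod_le[of "us @ vs"] c by auto
    then show False using Cons.prems by (simp add: reduced_def)
  qed
  moreover have "t = s" if "s = s \<otimes> t \<otimes> inv s" "t \<in> carrier W" for t
  proof -
    have "t \<otimes> inv s = \<one>"
      using that c l_cancel_one'[of s "t \<otimes> inv s"] by (simp add: m_assoc)
    then show ?thesis using that c by (metis gen_carrier inv_closed inv_equality inv_inv)
  qed
  ultimately show ?case
    using Cons.IH[OF reduced_ConsD(1)[OF Cons.prems]] rc
    by (auto simp: distinct_map intro: inj_on_subset[OF inj])
qed

text \<open>Some reduced word of \<open>wprod ws\<close> starts with \<open>s\<close>, so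
  \<open>s\<close> occurs exactly once among its walls. By parity \<open>s\<close> is also a wall of
  \<open>ws\<close>, and reflecting in it deletes a letter.\<close>

lemma exchange:
  assumes "s \<in> S" "ws \<in> lists S" "len (s \<otimes> wprod ws) < len (wprod ws)"
  shows "\<exists>us r vs. ws = us @ r # vs \<and> s \<otimes> wprod ws = wprod (us @ vs)"
proof -
  obtain vs where vs: "reduced vs" "wprod vs = s \<otimes> wprod ws"
    using reduced_word_exists[of "s \<otimes> wprod ws"] assms by auto
  have eq: "wprod (s # vs) = wprod ws" using vs assms by (simp add: gen_cancel)
  have "len (wprod ws) = len (s \<otimes> wprod ws) + 1" 
    using len_gen_mult_cases[of s "wprod ws"] assms by auto
  then have "reduced (s # vs)"
    using eq vs assms by (auto simp: reduced_def)
  then have "distinct (refls (s # vs))" by (rule distinct_refls)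
  then have "count_list (refls (s # vs)) s = 1" by (simp add: count_notin)
  then have "odd (count_list (refls ws) s)"
    using equal_words_invariants(2)[of "s # vs" ws s] eq assms vs by (auto simp: reduced_def)
  then have "s \<in> set (refls ws)" by (metis count_notin even_zero)
  then show ?thesis using refl_deletes_letter assms by blast
qed


lemma exchange_reduced:
  assumes "s \<in> S" "reduced ws" "len (s \<otimes> wprod ws) < len (wprod ws)"
  shows "\<exists>us r vs. ws = us @ r # vs \<and> s \<otimes> wprod ws = wprod (us @ vs) \<and> reduced (us @ vs)"
proof -
  have ws: "ws \<in> lists S" using assms(2) by (rule reduced_in_lists)
  obtain us r vs where eq: "ws = us @ r # vs" "s \<otimes> wprod ws = wprod (us @ vs)"
    using exchange[OF assms(1) ws assms(3)] by blast
  have "len (wprod ws) = len (s \<otimes> wprod ws) + 1"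
    using len_gen_mult_cases[of s "wprod ws"] assms ws by auto
  then have "reduced (us @ vs)" using eq assms(2) ws by (auto simp: reduced_def)
  then show ?thesis using eq by blast
qed

section \<open>Standard parabolic subgroups and their cores\<close>

lemma generate_subgroup: "K \<subseteq> S \<Longrightarrow> subgroup (generate W K) W"
  using gens_closed by (intro generate_is_subgroup) auto

lemma generate_closed: "K \<subseteq> S \<Longrightarrow> x \<in> generate W K \<Longrightarrow> x \<in> carrier W"
  by (rule subgroup.mem_carrier[OF generate_subgroup])

lemma generate_mult:
  "K \<subseteq> S \<Longrightarrow> x \<in> generate W K \<Longrightarrow> y \<in> generate W K \<Longrightarrow> x \<otimes> y \<in> generate W K"
  by (rule subgroup.m_closed[OF generate_subgroup])

lemma generate_inv: "K \<subseteq> S \<Longrightarrow> x \<in> generate W K \<Longrightarrow> inv x \<in> generate W K"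
  by (rule subgroup.m_inv_closed[OF generate_subgroup])

lemma generate_word_exists:
  assumes "K \<subseteq> S" "x \<in> generate W K"
  shows "\<exists>ws \<in> lists K. wprod ws = x"
proof -
  have "x \<in> wprod ` lists K" using assms generate_words[of K] by simp
  then show ?thesis by (rule imageE) blast
qed

text \<open>Letters are prepended one by one; when the length drops, exchange merely deletes a
  letter of the word found so far, so no letter outside \<open>K\<close> enters.\<close>

lemma reduced_word_in_generate:
  assumes "K \<subseteq> S" "x \<in> generate W K"
  shows "\<exists>ws \<in> lists K. reduced ws \<and> wprod ws = x"
proof -
  have "\<exists>rs \<in> lists K. reduced rs \<and> wprod rs = wprod ws" if "ws \<in> lists K" for ws
    using that
  proof (induction ws rule: list.induct)
    case Nil
    show ?case by (intro bexI[of _ "[]"]) (auto simp: reduced_def)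
  next
    case (Cons k ws)
    then obtain rs where rs: "rs \<in> lists K" "reduced rs" "wprod rs = wprod ws" by auto
    have k: "k \<in> K" "k \<in> S" using Cons assms by auto
    have rsS: "rs \<in> lists S" using rs by (auto simp: reduced_def)
    show ?case
    proof (cases "len (k \<otimes> wprod rs) < len (wprod rs)")
      case True
      then obtain us r vs where "rs = us @ r # vs" "k \<otimes> wprod rs = wprod (us @ vs)" "reduced (us @ vs)"
        using exchange_reduced k rs by blast
      then show ?thesis using rs by (intro bexI[of _ "us @ vs"]) auto
    next
      case False
      then have "len (k \<otimes> wprod rs) = len (wprod rs) + 1"
        using len_gen_mult_cases[of k "wprod rs"] k rsS by auto
      then have "reduced (k # rs)"
        using k rs by (auto simp: reduced_def)
      then show ?thesis using rs k by (intro bexI[of _ "k # rs"]) auto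
    qed
  qed
  then show ?thesis using generate_word_exists[OF assms] by blast
qed

lemma gen_in_generate:
  assumes "K \<subseteq> S" "s \<in> S" "s \<in> generate W K"
  shows "s \<in> K"
proof -
  obtain ws where ws: "ws \<in> lists K" "reduced ws" "wprod ws = s"
    using reduced_word_in_generate assms by blast
  then have "length ws = 1" using assms len_gen by (simp add: reduced_def)
  then obtain k where "ws = [k]" by (auto simp: length_Suc_conv)
  moreover from this have "k \<in> carrier W" using ws assms by auto
  ultimately show ?thesis using ws by simp
qed

text \<open>Exchange turns \<open>s \<otimes> x\<close> into a subword of a word over
  \<open>K\<close>, which puts \<open>s\<close> itself into the subgroup.\<close>

lemma descent_in_generate:
  assumes "K \<subseteq> S" "x \<in> generate W K" "s \<in> S" "len (s \<otimes> x) < len x"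
  shows "s \<in> K"
proof -
  obtain ws where ws: "ws \<in> lists K" "wprod ws = x"
    using generate_word_exists[OF assms(1,2)] by blast
  then have "ws \<in> lists S" using assms(1) by auto
  then obtain us r vs where eq: "ws = us @ r # vs" "s \<otimes> x = wprod (us @ vs)"
    using exchange[of s ws] ws assms by blast
  then have "s \<otimes> x \<in> generate W K" using generate_words[of K] assms(1) ws by auto
  then have "s \<otimes> x \<otimes> inv x \<in> generate W K"
    using generate_mult generate_inv assms by blast
  moreover have "s \<otimes> x \<otimes> inv x = s"
    using assms generate_closed by (simp add: m_assoc)
  ultimately show ?thesis using gen_in_generate assms by simp
qed

lemma exists_left_descent:
  assumes "K \<subseteq> S" "x \<in> generate W K" "x \<noteq> \<one>"
  shows "\<exists>s \<in> K. s \<otimes> x \<in> generate W K \<and> len x = len (s \<otimes> x) + 1"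
proof -
  obtain ws where ws: "ws \<in> lists K" "reduced ws" "wprod ws = x"
    using reduced_word_in_generate assms by blast
  then obtain s vs where eq: "ws = s # vs" using assms by (cases ws) auto
  have s: "s \<in> K" "s \<in> S" "vs \<in> lists S" "vs \<in> lists K" using ws eq assms by auto
  then have "s \<otimes> x = wprod vs" using ws eq by (auto simp: gen_cancel)
  moreover from this have "s \<otimes> x \<in> generate W K" using generate_words[of K] assms s by auto
  ultimately show ?thesis
    using reduced_ConsD(2)[of s vs] ws eq s by (intro bexI[of _ s]) auto
qed

section \<open>Parabolic subgroups avoiding one generator\<close>

lemma len_mult_avoided_gen:
  assumes "t \<in> S" "x \<in> generate W (S - {t})"
  shows "len (t \<otimes> x) = len x + 1" "len (x \<otimes> t) = len x + 1"
proof -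
  have up: "len (t \<otimes> y) = len y + 1" if "y \<in> generate W (S - {t})" for y
  proof -
    have y: "y \<in> carrier W" using that generate_closed[of "S - {t}"] by auto
    show ?thesis
      using len_gen_mult_cases[OF assms(1) y] descent_in_generate[of "S - {t}" y t] that assms(1) by force
  qed
  show "len (t \<otimes> x) = len x + 1" using up assms by blast
  have "inv x \<in> generate W (S - {t})" using generate_inv[of "S - {t}"] assms by blast
  moreover have "x \<in> carrier W" using assms generate_closed[of "S - {t}"] by auto
  ultimately show "len (x \<otimes> t) = len x + 1"
    using up[of "inv x"] assms len_inv[of "x \<otimes> t"] len_inv[of x] by (simp add: inv_mult_gen)
qed

text \<open>Since \<open>s t = t (t s t)\<close> has length at most two and exceeds
  \<open>t s t\<close> by one, \<open>t s t\<close> is a single generator \<open>r\<close>. Exchange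
  for \<open>t\<close> in the word \<open>[r, t]\<close> of \<open>t s\<close> leaves one letter
  equal to \<open>s\<close>, and it must be \<open>r\<close>.\<close>

lemma commute_if_conj_avoids:
  assumes "s \<in> S" "t \<in> S" "s \<noteq> t" "t \<otimes> s \<otimes> t \<in> generate W (S - {t})"
  shows "s \<otimes> t = t \<otimes> s"
proof -
  let ?y = "t \<otimes> s \<otimes> t"
  have ty: "t \<otimes> ?y = s \<otimes> t" using assms by (simp add: m_assoc gen_cancel)
  have l: "len (s \<otimes> t) = len ?y + 1" using len_mult_avoided_gen[OF assms(2,4)] ty by simp
  have "s \<otimes> t \<noteq> t" using assms gen_neq_one[of s] by simp
  have "?y \<noteq> \<one>"
  proof
    assume "?y = \<one>"
    then have "s \<otimes> t = t" using ty assms by simp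
    then show False using \<open>s \<otimes> t \<noteq> t\<close> by simp
  qed
  moreover have "len (s \<otimes> t) \<le> 2" using len_mult_le[of s t] assms len_gen by simp
  moreover have "?y \<in> carrier W" using assms by simp
  ultimately have y1: "len ?y = 1" using l len_eq_0[of ?y] by linarith
  obtain ws where ws: "reduced ws" "wprod ws = ?y" using reduced_word_exists[of ?y] assms by auto
  then have "length ws = 1" using y1 by (simp add: reduced_def)
  then obtain r where r: "ws = [r]" by (auto simp: length_Suc_conv)
  have rS: "r \<in> S" "?y = r" using ws r by (auto simp: reduced_def)
  have ts: "t \<otimes> s = r \<otimes> t" using rS(2) assms gen_cancel_right[of t "t \<otimes> s"] by simp
  have "len (t \<otimes> s) = 2" using len_inv[of "s \<otimes> t"] l y1 assms by (simp add: inv_mult_gen inv_gen)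
  then have "len (t \<otimes> wprod [r, t]) < len (wprod [r, t])"
    using assms(1,2) rS(1) by (simp add: ts[symmetric] gen_cancel len_gen)
  moreover have "[r, t] \<in> lists S" using assms(2) rS(1) by simp
  ultimately obtain us q vs where "[r, t] = us @ q # vs" "t \<otimes> wprod [r, t] = wprod (us @ vs)"
    using exchange[OF assms(2)] by blast
  moreover have "t \<otimes> wprod [r, t] = s" using assms(1,2) rS(1) by (simp add: ts[symmetric] gen_cancel)
  ultimately have "s = t \<or> s = r"
    using assms(1,2) rS(1) by (auto simp: Cons_eq_append_conv)
  then show ?thesis using ts assms(3) by metis
qed

text \<open>Bounds the intersection of the parabolic subgroup missing \<open>t\<close> with its
  conjugate by \<open>t\<close>. The induction strips off a left descent \<open>s\<close> of
  \<open>x\<close> after showing that it commutes with \<open>t\<close>.\<close>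

lemma commutes_if_conj_avoids:
  assumes "t \<in> S" "x \<in> generate W (S - {t})" "t \<otimes> x \<otimes> t \<in> generate W (S - {t})"
  shows "x \<in> generate W {s \<in> S - {t}. s \<otimes> t = t \<otimes> s}"
  using assms(2,3)
proof (induction "len x" arbitrary: x)
  case 0
  then have "x = \<one>" using len_eq_0 generate_closed[of "S - {t}" x] by auto
  then show ?case by (simp add: generate.one)
next
  case (Suc n)
  let ?L = "S - {t}" and ?y = "t \<otimes> x \<otimes> t"
  have L: "?L \<subseteq> S" by auto
  have c: "x \<in> carrier W" "?y \<in> carrier W" using generate_closed[OF L] Suc.prems by auto
  have "x \<noteq> \<one>" using Suc.hyps(2) by auto
  then obtain s where s: "s \<in> ?L" "s \<otimes> x \<in> generate W ?L" "len x = len (s \<otimes> x) + 1"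
    using exists_left_descent[OF L Suc.prems(1)] by blast
  obtain ys where ys: "ys \<in> lists ?L" "wprod ys = ?y"
    using generate_word_exists[OF L Suc.prems(2)] by blast
  have ysS: "ys \<in> lists S" using ys by auto
  have ty: "wprod (t # ys) = x \<otimes> t" using ys assms(1) c by (simp add: m_assoc gen_cancel)
  \<comment> \<open>Right multiplication by \<open>t\<close> adds one to the lengths of both
    \<open>x\<close> and \<open>s x\<close>, so \<open>s\<close> is also a left descent of
    \<open>x t = t y\<close>.\<close>
  have "len (s \<otimes> wprod (t # ys)) < len (wprod (t # ys))"
    using len_mult_avoided_gen(2)[OF assms(1) s(2)] len_mult_avoided_gen(2)[OF assms(1) Suc.prems(1)]
      s c assms(1) unfolding ty by (simp add: m_assoc)
  moreover have "s \<in> S" "t # ys \<in> lists S" using s ysS assms(1) by auto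
  ultimately obtain us r vs where eq: "t # ys = us @ r # vs" "s \<otimes> wprod (t # ys) = wprod (us @ vs)"
    using exchange by blast
  \<comment> \<open>Deleting the leading \<open>t\<close> would force \<open>s t = \<one>\<close>,
    so the deleted letter comes from \<open>ys\<close>.\<close>
  have us: "us \<noteq> []"
  proof
    assume "us = []"
    then have "s \<otimes> (t \<otimes> ?y) = ?y" using eq ys by simp
    then have "s \<otimes> t = \<one>" using s assms(1) c by (simp add: m_assoc[symmetric])
    then have "s = t" using s assms(1) inv_equality[of s t] by (simp add: inv_gen)
    then show False using s by simp
  qed
  then obtain us' where us': "us = t # us'" "ys = us' @ r # vs" using eq(1) by (cases us) auto
  let ?z = "wprod (us' @ vs)"
  have z: "?z \<in> generate W ?L" using generate_words[OF L] ys us' by auto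
  then have zc: "?z \<in> carrier W" using generate_closed[OF L] by blast
  have "s \<otimes> (t \<otimes> ?y) = t \<otimes> ?z" using eq us' ys by simp
  then have "t \<otimes> (s \<otimes> (t \<otimes> ?y)) = ?z" using zc assms(1) by (simp add: gen_cancel)
  \<comment> \<open>Solving \<open>s t y = t z\<close> for \<open>t s t\<close> shows that this
    conjugate avoids \<open>t\<close>, as \<open>commute_if_conj_avoids\<close> requires.\<close>
  then have "t \<otimes> s \<otimes> t \<otimes> ?y \<otimes> inv ?y = ?z \<otimes> inv ?y" using s assms(1) c by (simp add: m_assoc)
  then have "t \<otimes> s \<otimes> t = ?z \<otimes> inv ?y" using s assms(1) c by (simp add: m_assoc)
  also have "\<dots> \<in> generate W ?L" using z Suc.prems generate_mult[OF L] generate_inv[OF L] by blast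
  finally have comm: "s \<otimes> t = t \<otimes> s" using commute_if_conj_avoids[of s t] s assms(1) by auto
  have "t \<otimes> (s \<otimes> x) \<otimes> t = t \<otimes> s \<otimes> x \<otimes> t" using s assms(1) c by (simp add: m_assoc)
  also have "\<dots> = s \<otimes> ?y" using s assms(1) c by (simp add: m_assoc comm[symmetric])
  also have "\<dots> \<in> generate W ?L" using s Suc.prems generate_mult[OF L] generate.incl[of s ?L] by blast
  finally have "s \<otimes> x \<in> generate W {s \<in> S - {t}. s \<otimes> t = t \<otimes> s}"
    using Suc.hyps s by auto
  moreover have "s \<in> generate W {s \<in> S - {t}. s \<otimes> t = t \<otimes> s}"
    using s comm by (intro generate.incl) auto
  ultimately have "s \<otimes> (s \<otimes> x) \<in> generate W {s \<in> S - {t}. s \<otimes> t = t \<otimes> s}"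
    by (rule generate.eng[rotated])
  then show ?case using s c by (simp add: gen_cancel)
qed

section \<open>Normal cores and diagram components\<close>

lemma diagram_edge_not_commute:
  assumes "diagram_edge W S s t"
  shows "s \<otimes> t \<noteq> t \<otimes> s"
proof
  assume eq: "s \<otimes> t = t \<otimes> s"
  have st: "s \<in> S" "t \<in> S" using assms by (auto simp: diagram_edge_def)
  have "(s \<otimes> t) [^] (2::nat) = s \<otimes> t \<otimes> (t \<otimes> s)" using st eq by (simp add: numeral_2_eq_2)
  also have "\<dots> = \<one>" using st by (simp add: m_assoc gen_cancel gen_square)
  finally have "ord (s \<otimes> t) dvd 2" using st pow_eq_id[of "s \<otimes> t" 2] by simp
  then show False using assms dvd_imp_le[of "ord (s \<otimes> t)" 2] by (auto simp: diagram_edge_def)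
qed

text \<open>The kernel of the action of \<open>W\<close> by right multiplication on the right cosets
  of \<open>generate W K\<close>.\<close>

definition core :: "'a set \<Rightarrow> 'a set" where
  "core K = {x \<in> carrier W. \<forall>y \<in> carrier W. y \<otimes> x \<otimes> inv y \<in> generate W K}"

lemma core_conj:
  assumes "x \<in> core K" "r \<in> carrier W"
  shows "r \<otimes> x \<otimes> inv r \<in> core K"
proof -
  have "y \<otimes> (r \<otimes> x \<otimes> inv r) \<otimes> inv y = (y \<otimes> r) \<otimes> x \<otimes> inv (y \<otimes> r)" if "y \<in> carrier W" for y
    using that assms by (simp add: core_def m_assoc inv_mult_group)
  then show ?thesis using assms by (auto simp: core_def)
qed

lemma core_subset: "core K \<subseteq> generate W K"
  by (force simp: core_def dest: bspec[of _ _ \<one>])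

text \<open>The core is stable under conjugation by \<open>t\<close>, so \<open>x\<close> and
  \<open>t x t\<close> both avoid \<open>t\<close>. Hence \<open>x\<close> is a product of
  generators commuting with \<open>t\<close>, and the neighbour \<open>s\<close> is not one of
  them.\<close>

lemma core_avoids_neighbour:
  assumes "core K \<subseteq> generate W (S - {t})" "diagram_edge W S s t"
  shows "core K \<subseteq> generate W (S - {s})"
proof
  fix x assume x: "x \<in> core K"
  have t: "t \<in> S" using assms by (auto simp: diagram_edge_def)
  have "t \<otimes> x \<otimes> t \<in> core K" using core_conj[OF x, of t] t by (simp add: inv_gen)
  then have "x \<in> generate W {s \<in> S - {t}. s \<otimes> t = t \<otimes> s}"
    using commutes_if_conj_avoids[OF t] x assms by blast
  then show "x \<in> generate W (S - {s})"
    using mono_generate[of "{s \<in> S - {t}. s \<otimes> t = t \<otimes> s}" "S - {s}"]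
      diagram_edge_not_commute[OF assms(2)] by blast
qed

text \<open>Avoidance spreads from \<open>t\<close> along diagram paths to all of \<open>T\<close>,
  whereas a nontrivial element of \<open>generate W T\<close> has a left descent in
  \<open>T\<close>.\<close>

lemma core_inter_component:
  assumes "K \<subseteq> S - {t}" "t \<in> S" "T \<subseteq> S" "\<And>s. s \<in> T \<Longrightarrow> (diagram_edge W S)\<^sup>*\<^sup>* t s"
  shows "core K \<inter> generate W T \<subseteq> {\<one>}"
proof
  fix x assume x: "x \<in> core K \<inter> generate W T"
  have avoid: "core K \<subseteq> generate W (S - {s})" if "(diagram_edge W S)\<^sup>*\<^sup>* t s" for s
    using that
  proof (induction rule: rtranclp_induct)
    case base
    show ?case using core_subset mono_generate[OF assms(1)] by blast
  next
    case (step y z)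
    have "diagram_edge W S z y"
    proof -
      have yz: "y \<in> S" "z \<in> S" using step by (auto simp: diagram_edge_def)
      have "inv (y \<otimes> z) = z \<otimes> y" using yz by (simp add: inv_mult_gen inv_gen)
      then have "ord (z \<otimes> y) = ord (y \<otimes> z)" using yz ord_inv[of "y \<otimes> z"] by simp
      then show ?thesis using step by (auto simp: diagram_edge_def)
    qed
    then show ?case using core_avoids_neighbour step by blast
  qed
  show "x \<in> {\<one>}"
  proof (rule ccontr)
    assume "x \<notin> {\<one>}"
    then obtain s where s: "s \<in> T" "len x = len (s \<otimes> x) + 1"
      using exists_left_descent[OF assms(3)] x by blast
    then have "x \<in> generate W (S - {s})" using x avoid assms(4) by blast
    then show False
      using descent_in_generate[of "S - {s}" x s] s assms(3) by auto
  qed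
qed

lemma finite_component:
  assumes "K \<subseteq> S - {t}" "t \<in> S" "T \<subseteq> S" "\<And>s. s \<in> T \<Longrightarrow> (diagram_edge W S)\<^sup>*\<^sup>* t s"
    and F: "finite F" "F \<subseteq> carrier W" "\<And>x. x \<in> carrier W \<Longrightarrow> \<exists>k \<in> generate W K. \<exists>f \<in> F. x = k \<otimes> f"
  shows "finite (generate W T)"
proof -
  have K: "K \<subseteq> S" using assms by auto
  \<comment> \<open>\<open>h g f\<close> picks a representative in \<open>F\<close> of the coset of
    \<open>f \<otimes> g\<close>. As \<open>F\<close> may represent a coset more than once,
    \<open>h g\<close> is treated only as a self-map of \<open>F\<close>; finiteness needs no
    more.\<close>
  define h where "h g = (\<lambda>f \<in> F. SOME f'. f' \<in> F \<and> (\<exists>k \<in> generate W K. f \<otimes> g = k \<otimes> f'))" for g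
  have h: "h g f \<in> F \<and> (\<exists>k \<in> generate W K. f \<otimes> g = k \<otimes> h g f)" if "g \<in> carrier W" "f \<in> F" for g f
  proof -
    have "\<exists>f'. f' \<in> F \<and> (\<exists>k \<in> generate W K. f \<otimes> g = k \<otimes> f')" using F that by blast
    from someI_ex[OF this] show ?thesis using that by (simp add: h_def)
  qed
  have gT: "generate W T \<subseteq> carrier W" using generate_closed[OF assms(3)] by blast
  have "h ` generate W T \<subseteq> PiE F (\<lambda>_. F)"
  proof (rule image_subsetI)
    fix g assume "g \<in> generate W T"
    then have "h g f \<in> F" if "f \<in> F" for f using h[of g f] gT that by blast
    moreover have "h g \<in> extensional F" by (simp add: h_def)
    ultimately show "h g \<in> PiE F (\<lambda>_. F)" by (simp add: PiE_iff)
  qed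
  then have "finite (h ` generate W T)" using F(1) finite_PiE[of F "\<lambda>_. F"] finite_subset by blast
  moreover have "inj_on h (generate W T)"
  proof (rule inj_onI)
    fix a b assume ab: "a \<in> generate W T" "b \<in> generate W T" "h a = h b"
    have c: "a \<in> carrier W" "b \<in> carrier W" using ab gT by auto
    \<comment> \<open>Equal maps give \<open>f a = l f'\<close> and \<open>f b = m f'\<close> with
      the same \<open>f'\<close>, so conjugating \<open>a b^-1\<close> by \<open>y = k f\<close>
      yields \<open>k l m^-1 k^-1\<close>.\<close>
    have "y \<otimes> (a \<otimes> inv b) \<otimes> inv y \<in> generate W K" if y: "y \<in> carrier W" for y
    proof -
      obtain k f where kf: "k \<in> generate W K" "f \<in> F" "y = k \<otimes> f" using F(3)[OF y] by blast
      obtain l m where lm: "l \<in> generate W K" "f \<otimes> a = l \<otimes> h a f" "m \<in> generate W K" "f \<otimes> b = m \<otimes> h a f"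
        using h[OF c(1) kf(2)] h[OF c(2) kf(2)] ab(3) by metis
      have lc: "k \<in> carrier W" "l \<in> carrier W" "m \<in> carrier W" "f \<in> carrier W" "h a f \<in> carrier W"
        using kf lm generate_closed[OF K] F h[OF c(1) kf(2)] by auto
      have "y \<otimes> (a \<otimes> inv b) \<otimes> inv y = k \<otimes> ((f \<otimes> a) \<otimes> inv (f \<otimes> b)) \<otimes> inv k"
        using kf(3) lc c by (simp add: m_assoc inv_mult_group)
      also have "(f \<otimes> a) \<otimes> inv (f \<otimes> b) = l \<otimes> (h a f \<otimes> (inv (h a f) \<otimes> inv m))"
        unfolding lm(2,4) using lc by (simp add: m_assoc inv_mult_group)
      also have "\<dots> = l \<otimes> inv m" using lc by (simp add: m_assoc[symmetric])
      finally show ?thesis using kf lm generate_mult[OF K] generate_inv[OF K] by simp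
    qed
    then have "a \<otimes> inv b \<in> core K" using c by (simp add: core_def)
    moreover have "a \<otimes> inv b \<in> generate W T"
      using ab generate_mult[OF assms(3)] generate_inv[OF assms(3)] by blast
    ultimately have "a \<otimes> inv b = \<one>" using core_inter_component[OF assms(1-4)] by blast
    then show "a = b" using c inv_equality[of a "inv b"] by simp
  qed
  ultimately show ?thesis using finite_imageD by blast
qed

section \<open>Demazure products\<close>

text \<open>
  The generators of the 0-Hecke monoid acting on \<open>W\<close> from the left and from the right.
\<close>

definition lop :: "'a \<Rightarrow> 'a \<Rightarrow> 'a" where
  "lop s u = (if len u < len (s \<otimes> u) then s \<otimes> u else u)"

definition rop :: "'a \<Rightarrow> 'a \<Rightarrow> 'a" where
  "rop s u = (if len u < len (u \<otimes> s) then u \<otimes> s else u)"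

lemma lop_closed [simp]: "s \<in> S \<Longrightarrow> u \<in> carrier W \<Longrightarrow> lop s u \<in> carrier W"
  by (simp add: lop_def)

lemma rop_closed [simp]: "s \<in> S \<Longrightarrow> u \<in> carrier W \<Longrightarrow> rop s u \<in> carrier W"
  by (simp add: rop_def)

text \<open>Exchange in the word \<open>ws @ [r]\<close> must delete the final \<open>r\<close>:
  deleting a letter of \<open>ws\<close> would make \<open>s \<otimes> u\<close> shorter than
  \<open>u\<close>.\<close>

lemma double_ascent_eq:
  assumes "s \<in> S" "r \<in> S" "u \<in> carrier W"
    and "len u < len (s \<otimes> u)" "len u < len (u \<otimes> r)" "len (s \<otimes> (u \<otimes> r)) < len (u \<otimes> r)"
  shows "s \<otimes> u = u \<otimes> r"
proof -
  obtain ws where ws: "reduced ws" "wprod ws = u" using assms reduced_word_exists by blast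
  have wsS: "ws \<in> lists S" using ws reduced_in_lists by blast
  have eq: "wprod (ws @ [r]) = u \<otimes> r" using ws wsS assms by (auto simp: wprod_append)
  obtain us q vs where e: "ws @ [r] = us @ q # vs" "s \<otimes> (u \<otimes> r) = wprod (us @ vs)"
    using exchange[of s "ws @ [r]"] wsS assms eq by auto
  show ?thesis
  proof (cases vs rule: rev_cases)
    case Nil
    then have "s \<otimes> u \<otimes> r \<otimes> r = u \<otimes> r" using e ws assms by (simp add: m_assoc)
    then show ?thesis using gen_cancel_right[of r "s \<otimes> u"] assms by simp
  next
    case (snoc vs' r')
    then have ws': "ws = us @ q # vs'" "r' = r" using e(1) by auto
    then have c: "us @ vs' \<in> lists S" using wsS by auto
    have "s \<otimes> u \<otimes> r = wprod (us @ vs') \<otimes> r"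
      using e(2) snoc ws' c assms wprod_append[of "us @ vs'" "[r]"] by (auto simp: m_assoc)
    then have "s \<otimes> u = wprod (us @ vs')" using assms c by auto
    then have "len (s \<otimes> u) \<le> length (us @ vs')" using len_wprod_le[OF c] by simp
    then show ?thesis using ws ws' assms by (auto simp: reduced_def)
  qed
qed

text \<open>An instance of associativity of the Demazure product. Only case \<open>eq\<close> goes
  beyond comparing lengths: there both sides equal \<open>u \<otimes> r\<close> by
  \<open>double_ascent_eq\<close>.\<close>

lemma lop_rop_commute:
  assumes "s \<in> S" "r \<in> S" "u \<in> carrier W"
  shows "lop s (rop r u) = rop r (lop s u)"
proof -
  have a: "s \<otimes> u \<otimes> r = s \<otimes> (u \<otimes> r)" and su: "s \<otimes> u \<in> carrier W" and ur: "u \<otimes> r \<in> carrier W"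
    using assms by (simp_all add: m_assoc)
  note c = len_gen_mult_cases[OF assms(1,3)] len_mult_gen_cases[OF assms(2,3)]
    len_gen_mult_cases[OF assms(1) ur] len_mult_gen_cases[OF assms(2) su, unfolded a]
  consider (up) "len u < len (s \<otimes> u)" "len u < len (u \<otimes> r)" "len (u \<otimes> r) < len (s \<otimes> (u \<otimes> r))"
    | (eq) "len u < len (s \<otimes> u)" "len u < len (u \<otimes> r)" "len (s \<otimes> (u \<otimes> r)) < len (u \<otimes> r)"
    | (left) "len u < len (s \<otimes> u)" "\<not> len u < len (u \<otimes> r)"
    | (right) "\<not> len u < len (s \<otimes> u)" "len u < len (u \<otimes> r)"
    | (down) "\<not> len u < len (s \<otimes> u)" "\<not> len u < len (u \<otimes> r)"
    using c by linarith
  then show ?thesis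
  proof cases
    case up
    moreover from this have "len (s \<otimes> u) < len (s \<otimes> (u \<otimes> r))" using c by linarith
    ultimately show ?thesis by (simp add: lop_def rop_def a)
  next
    case eq
    then have su: "s \<otimes> u = u \<otimes> r" using double_ascent_eq[OF assms] by blast
    have "u \<otimes> r \<otimes> r = u" using assms by (simp add: gen_cancel_right)
    then show ?thesis using eq(2,3) by (simp add: lop_def rop_def su)
  next
    case left
    moreover from this have "\<not> len (s \<otimes> u) < len (s \<otimes> (u \<otimes> r))" using c by linarith
    ultimately show ?thesis by (simp add: lop_def rop_def a)
  next
    case right
    moreover from this have "\<not> len (u \<otimes> r) < len (s \<otimes> (u \<otimes> r))" using c by linarith
    ultimately show ?thesis by (simp add: lop_def rop_def a)
  next
    case down
    then show ?thesis by (simp add: lop_def rop_def)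
  qed
qed

section \<open>Iterated left and right operations\<close>

lemma foldr_rop_closed [simp]:
  "ys \<in> lists S \<Longrightarrow> u \<in> carrier W \<Longrightarrow> foldr rop ys u \<in> carrier W"
  by (induction ys) auto

lemma lop_foldr_rop:
  "s \<in> S \<Longrightarrow> ys \<in> lists S \<Longrightarrow> u \<in> carrier W \<Longrightarrow> lop s (foldr rop ys u) = foldr rop ys (lop s u)"
  by (induction ys) (auto simp: lop_rop_commute in_listsI)

text \<open>The Demazure product keeps the reduced word \<open>xs\<close> intact as a prefix; all
  cancellation is charged to letters of \<open>ws\<close>.\<close>

lemma foldr_lop_reduced:
  assumes "reduced ws"
  shows "reduced xs \<Longrightarrow> \<exists>zs. subseq zs ws \<and> reduced (xs @ zs) \<and> foldr lop xs (wprod ws) = wprod (xs @ zs)"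
proof (induction xs)
  case Nil
  then show ?case using assms by auto
next
  case (Cons s xs)
  have xs: "reduced xs" "len (s \<otimes> wprod xs) = len (wprod xs) + 1" 
    using reduced_ConsD Cons.prems by blast+
  have s: "s \<in> S" "xs \<in> lists S" using Cons.prems by (auto simp: reduced_def)
  obtain zs where zs: "subseq zs ws" "reduced (xs @ zs)" "foldr lop xs (wprod ws) = wprod (xs @ zs)"
    using Cons.IH xs by blast
  have zsS: "xs @ zs \<in> lists S" using zs reduced_in_lists by blast
  show ?case
  proof (cases "len (wprod (xs @ zs)) < len (s \<otimes> wprod (xs @ zs))")
    case True
    then have "len (s \<otimes> wprod (xs @ zs)) = len (wprod (xs @ zs)) + 1"
      using len_gen_mult_cases[of s "wprod (xs @ zs)"] s zsS by auto
    then have "reduced (s # xs @ zs)" using zs s by (auto simp: reduced_def)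
    moreover have "foldr lop (s # xs) (wprod ws) = s \<otimes> wprod (xs @ zs)"
      using zs(3) True by (simp add: lop_def[of s])
    ultimately show ?thesis using zs(1) by (intro exI[of _ zs]) simp
  next
    case False
    then have "len (s \<otimes> wprod (xs @ zs)) < len (wprod (xs @ zs))"
      using len_gen_mult_cases[of s "wprod (xs @ zs)"] s zsS by auto
    from exchange_reduced[OF s(1) zs(2) this] obtain us q vs where
      e: "xs @ zs = us @ q # vs" "s \<otimes> wprod (xs @ zs) = wprod (us @ vs)" "reduced (us @ vs)" by blast
    \<comment> \<open>The deleted letter lies in \<open>zs\<close>, since a deletion inside
      \<open>xs\<close> would contradict that \<open>s # xs\<close> is reduced.\<close>
    have "\<exists>as. us = xs @ as \<and> zs = as @ q # vs"
    proof (rule ccontr)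
      assume "\<not> ?thesis"
      then obtain bs where b: "xs = us @ q # bs" "vs = bs @ zs"
        using e(1) by (auto simp: append_eq_append_conv2 append_eq_Cons_conv Cons_eq_append_conv)
      have c: "us @ bs \<in> lists S" "zs \<in> lists S" using b zsS by auto
      have "s \<otimes> wprod xs \<otimes> wprod zs = wprod (us @ bs) \<otimes> wprod zs"
        using e(2) b c s wprod_append[of xs zs] wprod_append[of "us @ bs" zs] by (auto simp: m_assoc)
      then have "s \<otimes> wprod xs = wprod (us @ bs)" using c s by auto
      then have "len (s \<otimes> wprod xs) \<le> length (us @ bs)" using len_wprod_le[OF c(1)] by simp
      then show False using xs b by (auto simp: reduced_def)
    qed
    then obtain as where as: "us = xs @ as" "zs = as @ q # vs" by blast
    \<comment> \<open>Prepending \<open>s\<close> compensates for deleting \<open>q\<close>: the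
      element and the number of letters are unchanged, so the new word is reduced too.\<close>
    have eq: "wprod (s # xs @ as @ vs) = wprod (xs @ zs)"
    proof -
      have "s \<otimes> wprod (us @ vs) = s \<otimes> (s \<otimes> wprod (xs @ zs))" using e(2) by simp
      also have "\<dots> = wprod (xs @ zs)" using s zsS by (auto simp: gen_cancel)
      finally show ?thesis using as by simp
    qed
    moreover have "reduced (s # xs @ as @ vs)"
      using zs(2) eq as s zsS by (auto simp: reduced_def)
    moreover have "subseq (as @ vs) ws"
    proof -
      have "subseq (as @ vs) zs" unfolding as(2) by (intro list_emb_append_mono) auto
      then show ?thesis using zs(1) subseq_order.trans by blast
    qed
    moreover have "foldr lop (s # xs) (wprod ws) = wprod (xs @ zs)"
      using zs(3) False by (simp add: lop_def[of s])
    ultimately show ?thesis by (intro exI[of _ "as @ vs"]) simp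
  qed
qed

text \<open>Compares two descriptions of the Demazure product of \<open>x\<close> with
  \<open>w\<close>: it is \<open>k w\<close> with \<open>k\<close> in \<open>generate W K\<close>,
  and it is \<open>x v\<close> with \<open>v\<close> a subword of a fixed reduced word of
  \<open>w\<close>.\<close>

lemma finite_index:
  assumes "w \<in> carrier W" "K \<subseteq> S" "\<tau> ` K \<subseteq> S"
    and comm: "\<And>s. s \<in> K \<Longrightarrow> s \<otimes> w = w \<otimes> \<tau> s"
    and down: "\<And>s. s \<in> S - K \<Longrightarrow> len (s \<otimes> w) < len w"
  shows "\<exists>F. finite F \<and> F \<subseteq> carrier W \<and> (\<forall>x \<in> carrier W. \<exists>k \<in> generate W K. \<exists>f \<in> F. x = k \<otimes> f)"
proof -
  \<comment> \<open>As \<open>w \<otimes> \<tau> s = s \<otimes> w\<close>, a right operation by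
    \<open>\<tau> s\<close> either fixes \<open>k \<otimes> w\<close> or turns it into
    \<open>(k \<otimes> s) \<otimes> w\<close>.\<close>
  have cosets: "foldr rop ys w \<in> carrier W \<and> (\<exists>k \<in> generate W K. foldr rop ys w = k \<otimes> w)" if "ys \<in> lists (\<tau> ` K)" for ys
    using that
  proof (induction ys rule: list.induct)
    case Nil
    show ?case using assms(1) by (auto intro!: bexI[of _ \<one>] generate.one)
  next
    case (Cons r ys)
    from Cons.prems obtain s where s: "s \<in> K" "r = \<tau> s" by auto
    have "ys \<in> lists (\<tau> ` K)" using Cons.prems by simp
    from Cons.IH[OF this] obtain k where k: "k \<in> generate W K" "foldr rop ys w = k \<otimes> w" by blast
    have c: "k \<in> carrier W" "s \<in> S" "r \<in> S"
      using generate_closed[OF assms(2) k(1)] s assms(2,3) by blast+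
    have "k \<otimes> w \<otimes> r = k \<otimes> s \<otimes> w" using s c assms(1) comm[OF s(1)] by (simp add: m_assoc)
    moreover have "k \<otimes> s \<in> generate W K" by (rule generate.eng[OF k(1) generate.incl[OF s(1)]])
    ultimately show ?case using k c assms(1) by (auto simp: rop_def[of r])
  qed
  \<comment> \<open>A left operation passes through the right ones to reach \<open>w\<close> itself.
    There a descent does nothing, and an ascent \<open>s\<close> acts as the right operation by
    \<open>\<tau> s\<close>.\<close>
  have orbit: "\<exists>ys \<in> lists (\<tau> ` K). foldr lop xs w = foldr rop ys w" if "xs \<in> lists S" for xs
    using that
  proof (induction xs rule: list.induct)
    case Nil
    show ?case by (intro bexI[of _ "[]"]) auto
  next
    case (Cons s xs)
    then obtain ys where ys: "ys \<in> lists (\<tau> ` K)" "foldr lop xs w = foldr rop ys w" by auto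
    have s: "s \<in> S" "ys \<in> lists S" using Cons ys assms(3) by auto
    have eq: "foldr lop (s # xs) w = foldr rop ys (lop s w)"
      using lop_foldr_rop s assms(1) ys by simp
    show ?case
    proof (cases "len w < len (s \<otimes> w)")
      case True
      then have "s \<in> K" using down[of s] s by auto
      then have "lop s w = rop (\<tau> s) w" using True comm by (simp add: lop_def rop_def)
      then show ?thesis using eq ys \<open>s \<in> K\<close> by (intro bexI[of _ "ys @ [\<tau> s]"]) auto
    next
      case False
      then have "lop s w = w" by (simp add: lop_def)
      then show ?thesis using eq ys by (intro bexI[of _ ys]) auto
    qed
  qed
  obtain ws where ws: "reduced ws" "wprod ws = w" using reduced_word_exists assms(1) by blast
  \<comment> \<open>Solving \<open>x v = k w\<close> gives \<open>x = k (w v^-1)\<close>, and there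
    are only finitely many subwords to take for \<open>v\<close>.\<close>
  define F where "F = (\<lambda>zs. w \<otimes> inv (wprod zs)) ` {zs. zs \<in> lists S \<and> subseq zs ws}"
  have "{zs. zs \<in> lists S \<and> subseq zs ws} \<subseteq> set (subseqs ws)" by (simp add: subset_iff)
  then have "finite F" unfolding F_def by (rule finite_imageI[OF finite_subset[OF _ finite_set]])
  moreover have "F \<subseteq> carrier W"
    unfolding F_def using assms(1) by (intro image_subsetI m_closed inv_closed wprod_closed) auto
  moreover have "\<exists>k \<in> generate W K. \<exists>f \<in> F. x = k \<otimes> f" if x: "x \<in> carrier W" for x
  proof -
    obtain xs where xs: "reduced xs" "wprod xs = x" using reduced_word_exists x by blast
    have xsS: "xs \<in> lists S" using xs reduced_in_lists by blast
    obtain zs where zs: "subseq zs ws" "reduced (xs @ zs)" "foldr lop xs w = wprod (xs @ zs)"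
      using foldr_lop_reduced[OF ws(1) xs(1)] ws by blast
    have zsS: "zs \<in> lists S" using reduced_in_lists[OF zs(2)] by auto
    obtain k where k: "k \<in> generate W K" "foldr lop xs w = k \<otimes> w"
    proof -
      obtain ys where "ys \<in> lists (\<tau> ` K)" "foldr lop xs w = foldr rop ys w" using orbit[OF xsS] by blast
      then show thesis using cosets[of ys] that by auto
    qed
    have c: "k \<in> carrier W" "wprod zs \<in> carrier W" using k generate_closed[OF assms(2)] zsS by auto
    have "x \<otimes> wprod zs = k \<otimes> w"
      using zs(3) k xs xsS zsS wprod_append[of xs zs] by auto
    then have "x \<otimes> wprod zs \<otimes> inv (wprod zs) = k \<otimes> w \<otimes> inv (wprod zs)" by simp
    then have "x = k \<otimes> (w \<otimes> inv (wprod zs))" using x c assms(1) by (simp add: m_assoc)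
    moreover have "w \<otimes> inv (wprod zs) \<in> F"
      unfolding F_def using zs(1) zsS by (intro imageI) simp
    ultimately show ?thesis using k(1) by blast
  qed
  ultimately show ?thesis by blast
qed


section \<open>Length under automorphisms of the Coxeter system\<close>

lemma wprod_map:
  assumes "\<sigma> \<in> hom W W" "ws \<in> lists (carrier W)"
  shows "\<sigma> (wprod ws) = wprod (map \<sigma> ws)"
proof -
  interpret h: group_hom W W \<sigma> using assms by unfold_locales auto
  show ?thesis using assms(2) by (induction ws rule: list.induct) auto
qed

lemma len_cox_automorphism:
  assumes "\<sigma> \<in> cox_automorphisms W S" "w \<in> carrier W"
  shows "len (\<sigma> w) = len w"
proof (rule antisym)
  have hom: "\<sigma> \<in> hom W W" and inj: "inj_on \<sigma> (carrier W)" and S: "\<sigma> ` S = S"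
    using assms(1) by (auto simp: cox_automorphisms_def iso_def bij_betw_def)
  have closed: "\<sigma> w \<in> carrier W" using hom assms(2) by (auto simp: hom_def)
  obtain ws where ws: "reduced ws" "wprod ws = w" using reduced_word_exists[OF assms(2)] by blast
  have wsS: "ws \<in> lists S" using ws(1) by (rule reduced_in_lists)
  then have "\<sigma> w = wprod (map \<sigma> ws)" using wprod_map[OF hom lists_gens_carrier[OF wsS]] ws by simp
  moreover have "map \<sigma> ws \<in> lists S" using imageI[OF wsS, of "map \<sigma>"] S by (simp only: lists_image[symmetric])
  ultimately show "len (\<sigma> w) \<le> len w"
    using len_wprod_le[of "map \<sigma> ws"] ws by (simp add: reduced_def)
  obtain vs where vs: "reduced vs" "wprod vs = \<sigma> w" using reduced_word_exists[OF closed] by blast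
  have "vs \<in> map \<sigma> ` lists S" using vs(1) S by (simp add: reduced_def lists_image[symmetric])
  then obtain us where us: "us \<in> lists S" "vs = map \<sigma> us" by blast
  have "\<sigma> (wprod us) = \<sigma> w" using wprod_map[OF hom lists_gens_carrier[OF us(1)]] us vs by simp
  then have "wprod us = w" using inj us(1) assms(2) by (meson inj_onD lists_gens_carrier wprod_closed)
  then show "len w \<le> len (\<sigma> w)" using len_wprod_le[OF us(1)] us vs by (auto simp: reduced_def)
qed

end

section \<open>Displacement of building automorphisms\<close>

context building
begin

lemma dist_self [simp]: "C \<in> Ch \<Longrightarrow> \<delta> C C = \<one>"
  using dist_one by blast

text \<open>Applying \<open>dist_adjacent\<close> with \<open>C\<close> itself as target leaves only
  \<open>s \<otimes> \<delta> D C = \<one>\<close>.\<close>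

lemma dist_sym_gen:
  assumes "C \<in> Ch" "D \<in> Ch" "\<delta> C D = s" "s \<in> S"
  shows "\<delta> D C = s"
proof -
  have "\<one> = s \<otimes> \<delta> D C \<or> \<one> = \<delta> D C"
    using dist_adjacent[of D C C s] assms by auto
  moreover have "\<delta> D C \<noteq> \<one>"
    using dist_one assms gen_neq_one by metis
  ultimately have "s \<otimes> \<delta> D C = \<one>" by metis
  then have "s \<otimes> (s \<otimes> \<delta> D C) = s" using assms by simp
  then show ?thesis using assms dist_closed by (simp add: gen_cancel)
qed

section \<open>Galleries and the Weyl distance\<close>

fun gallery :: "'a list \<Rightarrow> 'c \<Rightarrow> 'c \<Rightarrow> bool" where
  "gallery [] C D \<longleftrightarrow> C \<in> Ch \<and> C = D"
| "gallery (s # ws) C D \<longleftrightarrow> C \<in> Ch \<and> (\<exists>E \<in> Ch. \<delta> C E = s \<and> gallery ws E D)"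

lemma gallery_chambers: "gallery ws C D \<Longrightarrow> C \<in> Ch \<and> D \<in> Ch"
  by (induction ws arbitrary: C) auto

lemma gallery_append:
  "gallery (us @ vs) C D \<longleftrightarrow> (\<exists>E. gallery us C E \<and> gallery vs E D)"
  by (induction us arbitrary: C) (auto dest: gallery_chambers)

lemma gallery_rev: "ws \<in> lists S \<Longrightarrow> gallery ws C D \<Longrightarrow> gallery (rev ws) D C"
proof (induction ws arbitrary: C rule: list.induct)
  case Nil
  then show ?case by auto
next
  case (Cons s ws)
  then obtain E where "E \<in> Ch" "\<delta> C E = s" "gallery ws E D" "C \<in> Ch" by auto
  then show ?case using Cons dist_sym_gen[of C E s] by (auto simp: gallery_append)
qed

text \<open>\<open>dist_exists\<close> supplies the first step whether or not the letter shortens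
  the distance, so this covers unreduced words as well.\<close>

lemma gallery_exists:
  "ws \<in> lists S \<Longrightarrow> C \<in> Ch \<Longrightarrow> D \<in> Ch \<Longrightarrow> \<delta> C D = wprod ws \<Longrightarrow> gallery ws C D"
proof (induction ws arbitrary: C rule: list.induct)
  case Nil
  then show ?case using dist_one by simp
next
  case (Cons s ws)
  have s: "s \<in> S" "ws \<in> lists S" using Cons.prems by auto
  obtain E where E: "E \<in> Ch" "\<delta> E C = s" "\<delta> E D = s \<otimes> \<delta> C D"
    using dist_exists[of C D s] Cons.prems s by blast
  have "\<delta> E D = wprod ws" using E(3) Cons.prems(4) s by (simp add: gen_cancel)
  then have "gallery ws E D" using Cons.IH[OF s(2) E(1) Cons.prems(3)] by blast
  then show ?case using E dist_sym_gen[OF E(1) Cons.prems(2) E(2) s(1)] Cons.prems(2) by auto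
qed

text \<open>Read from its end, a reduced word gains length with every letter, so
  \<open>dist_adjacent_up\<close> determines each distance in turn.\<close>

lemma dist_reduced_gallery: "reduced ws \<Longrightarrow> gallery ws C D \<Longrightarrow> \<delta> C D = wprod ws"
proof (induction ws arbitrary: C rule: list.induct)
  case Nil
  then show ?case by auto
next
  case (Cons s ws)
  have red: "reduced ws" "len (s \<otimes> wprod ws) = len (wprod ws) + 1"
    using reduced_ConsD Cons.prems(1) by blast+
  have s: "s \<in> S" using reduced_in_lists[OF Cons.prems(1)] by simp
  obtain E where E: "E \<in> Ch" "\<delta> C E = s" "gallery ws E D" "C \<in> Ch" using Cons.prems(2) by auto
  have D: "D \<in> Ch" using gallery_chambers[OF E(3)] by simp
  have "\<delta> E D = wprod ws" using Cons.IH[OF red(1) E(3)] .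
  then show ?case using dist_adjacent_up[OF E(1) D E(4) s E(2)] red by simp
qed

text \<open>A gallery of reduced type, reversed, again has reduced type. This carries the axioms,
  which move the first chamber, over to the second one.\<close>

lemma dist_inv:
  assumes "C \<in> Ch" "D \<in> Ch"
  shows "\<delta> D C = inv (\<delta> C D)"
proof -
  obtain ws where ws: "reduced ws" "wprod ws = \<delta> C D"
    using reduced_word_exists[OF dist_closed[OF assms]] by blast
  have S: "ws \<in> lists S" using ws(1) by (rule reduced_in_lists)
  have "reduced (rev ws)"
    using len_inv[of "wprod ws"] inv_wprod[OF S] ws(1) S by (auto simp: reduced_def)
  moreover have "gallery (rev ws) D C"
    using gallery_rev[OF S gallery_exists[OF S assms]] ws by simp
  ultimately show ?thesis using dist_reduced_gallery ws inv_wprod[OF S] by simp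
qed

lemma inv_gen_mult_inv: "s \<in> S \<Longrightarrow> w \<in> carrier W \<Longrightarrow> inv (s \<otimes> inv w) = w \<otimes> s"
  by (simp add: inv_mult_group inv_gen)

section \<open>Moving the second chamber, panels and the triangle inequality\<close>

lemma dist_adjacent_right:
  assumes "C \<in> Ch" "D \<in> Ch" "E \<in> Ch" "s \<in> S" "\<delta> D E = s"
  shows "\<delta> C E \<in> {\<delta> C D \<otimes> s, \<delta> C D}"
proof -
  have "\<delta> E D = s" using dist_sym_gen assms by blast
  then have "\<delta> E C \<in> {s \<otimes> \<delta> D C, \<delta> D C}" using dist_adjacent assms by blast
  then have "inv (\<delta> E C) \<in> {inv (s \<otimes> inv (\<delta> C D)), inv (inv (\<delta> C D))}"
    using dist_inv[of C D] assms by auto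
  then show ?thesis
    using dist_inv[of E C] assms dist_closed[of C D] inv_gen_mult_inv[of s "\<delta> C D"] by simp
qed

lemma dist_adjacent_right_up:
  assumes "C \<in> Ch" "D \<in> Ch" "E \<in> Ch" "s \<in> S" "\<delta> D E = s"
    and "len (\<delta> C D \<otimes> s) = len (\<delta> C D) + 1"
  shows "\<delta> C E = \<delta> C D \<otimes> s"
proof -
  have c: "\<delta> C D \<in> carrier W" using dist_closed assms by blast
  have ED: "\<delta> E D = s" using dist_sym_gen assms by blast
  have "len (s \<otimes> \<delta> D C) = len (\<delta> D C) + 1"
    using assms c len_inv[of "\<delta> C D \<otimes> s"] len_inv[of "\<delta> C D"] dist_inv[of C D]
    by (simp add: inv_mult_gen)
  then have "\<delta> E C = s \<otimes> \<delta> D C" using dist_adjacent_up[OF assms(2,1,3,4) ED] by blast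
  then show ?thesis
    using dist_inv[of E C] dist_inv[of C D] assms c inv_gen_mult_inv[of s "\<delta> C D"] by simp
qed

lemma dist_same_panel:
  assumes "C \<in> Ch" "A \<in> Ch" "B \<in> Ch" "s \<in> S" "\<delta> C A = s" "\<delta> C B = s" "A \<noteq> B"
  shows "\<delta> A B = s"
proof -
  have "\<delta> A C = s" using dist_sym_gen assms by blast
  then have "\<delta> A B \<in> {s \<otimes> \<delta> C B, \<delta> C B}" using dist_adjacent assms by blast
  then show ?thesis using assms dist_one[of A B] gen_square[of s] by auto
qed

text \<open>Each step of a gallery from \<open>C\<close> to \<open>D\<close> changes the distance to
  \<open>E\<close> by at most one.\<close>

lemma gallery_dist_triangle:
  assumes "C \<in> Ch" "D \<in> Ch" "E \<in> Ch"
  shows "len (\<delta> C E) \<le> len (\<delta> C D) + len (\<delta> D E)"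
proof -
  have step: "len (\<delta> C E) \<le> length ws + len (\<delta> D E)" if "ws \<in> lists S" "gallery ws C D" for ws C
    using that
  proof (induction ws arbitrary: C rule: list.induct)
    case Nil
    then show ?case by auto
  next
    case (Cons s ws)
    have s: "s \<in> S" "ws \<in> lists S" using Cons.prems by auto
    obtain B where B: "B \<in> Ch" "\<delta> C B = s" "gallery ws B D" "C \<in> Ch" using Cons.prems(2) by auto
    have "\<delta> C E \<in> {s \<otimes> \<delta> B E, \<delta> B E}" using dist_adjacent[OF B(1) assms(3) B(4) s(1) B(2)] .
    moreover have "len (s \<otimes> \<delta> B E) \<le> len (\<delta> B E) + 1"
      using len_mult_le[of s "\<delta> B E"] len_gen[OF s(1)] s(1) dist_closed[OF B(1) assms(3)] by simp
    ultimately have "len (\<delta> C E) \<le> len (\<delta> B E) + 1" by auto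
    then show ?case using Cons.IH[OF s(2) B(3)] by simp
  qed
  obtain ws where ws: "reduced ws" "wprod ws = \<delta> C D"
    using reduced_word_exists[OF dist_closed[OF assms(1,2)]] by blast
  have S: "ws \<in> lists S" using ws(1) by (rule reduced_in_lists)
  show ?thesis
    using step[OF S gallery_exists[OF S assms(1,2)]] ws by (simp add: reduced_def)
qed

text \<open>When \<open>C\<close> moves in its \<open>s\<close>-panel, its image moves in a panel of
  type \<open>\<sigma> s\<close>. If \<open>\<sigma> s\<close> lengthens \<open>w\<close> on the
  right, maximality forces the equation; if it shortens \<open>w\<close>, thickness contradicts
  maximality.\<close>

lemma max_displacement_commute:
  assumes "thick S Ch \<delta>"
    and \<phi>: "\<phi> \<in> Bij Ch" and \<sigma>: "\<sigma> ` S \<subseteq> S"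
    and eq: "\<And>C D. C \<in> Ch \<Longrightarrow> D \<in> Ch \<Longrightarrow> \<delta> (\<phi> C) (\<phi> D) = \<sigma> (\<delta> C D)"
    and C: "C \<in> Ch" and max: "\<And>D. D \<in> Ch \<Longrightarrow> len (\<delta> D (\<phi> D)) \<le> len (\<delta> C (\<phi> C))"
    and s: "s \<in> S" and up: "len (\<delta> C (\<phi> C)) < len (s \<otimes> \<delta> C (\<phi> C))"
  shows "s \<otimes> \<delta> C (\<phi> C) = \<delta> C (\<phi> C) \<otimes> \<sigma> s"
proof -
  let ?w = "\<delta> C (\<phi> C)" and ?r = "\<sigma> s"
  have ch: "\<phi> D \<in> Ch" if "D \<in> Ch" for D using Bij_imp_funcset[OF \<phi>] that by auto
  have r: "?r \<in> S" using \<sigma> s by auto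
  have w: "?w \<in> carrier W" using dist_closed C ch by blast
  have sw: "len (s \<otimes> ?w) = len ?w + 1" using len_gen_mult_cases[OF s w] up by linarith
  obtain A B where AB: "A \<in> Ch" "B \<in> Ch" "A \<noteq> B" "\<delta> C A = s" "\<delta> C B = s"
    using assms(1) C s unfolding thick_def by blast
  have pAB: "\<delta> (\<phi> C) (\<phi> A) = ?r" "\<delta> (\<phi> C) (\<phi> B) = ?r" using eq C AB by auto
  show ?thesis
  proof (cases "len ?w < len (?w \<otimes> ?r)")
    case True
    \<comment> \<open>Otherwise passing from \<open>C\<close> to \<open>A\<close> lengthens the
      distance once at each end, exceeding the maximum by two.\<close>
    have "len (s \<otimes> (?w \<otimes> ?r)) < len (?w \<otimes> ?r)"
    proof (rule ccontr)
      assume "\<not> ?thesis"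
      then have l: "len (s \<otimes> (?w \<otimes> ?r)) = len (?w \<otimes> ?r) + 1"
        using len_gen_mult_cases[of s "?w \<otimes> ?r"] s r w by auto
      have wr: "len (?w \<otimes> ?r) = len ?w + 1" using len_mult_gen_cases[OF r w] True by linarith
      have A: "\<delta> A C = s" using dist_sym_gen[OF C AB(1) AB(4) s] .
      have AC: "\<delta> A (\<phi> C) = s \<otimes> ?w"
        using dist_adjacent_up[OF C ch[OF C] AB(1) s A] sw by simp
      have "len (s \<otimes> ?w \<otimes> ?r) = len (s \<otimes> ?w) + 1"
        using l wr sw s r w by (simp add: m_assoc)
      then have "\<delta> A (\<phi> A) = s \<otimes> ?w \<otimes> ?r"
        using dist_adjacent_right_up[OF AB(1) ch[OF C] ch[OF AB(1)] r pAB(1)] AC by simp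
      then have "len (\<delta> A (\<phi> A)) = len ?w + 2"
        using \<open>len (s \<otimes> ?w \<otimes> ?r) = len (s \<otimes> ?w) + 1\<close> sw by simp
      then show False using max[OF AB(1)] by simp
    qed
    then show ?thesis using double_ascent_eq[OF s r w up True] by simp
  next
    case False
    then have wr: "len ?w = len (?w \<otimes> ?r) + 1" using len_mult_gen_cases[OF r w] by linarith
    \<comment> \<open>At most one chamber of the panel of \<open>\<phi> C\<close> is nearer to
      \<open>C\<close>, so \<open>\<phi> A\<close> and \<open>\<phi> B\<close> cannot both
      be.\<close>
    have "\<delta> C (\<phi> A) = ?w \<or> \<delta> C (\<phi> B) = ?w"
    proof (rule ccontr)
      assume "\<not> ?thesis"
      then have eqs: "\<delta> C (\<phi> A) = ?w \<otimes> ?r" "\<delta> C (\<phi> B) = ?w \<otimes> ?r"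
        using dist_adjacent_right[OF C ch[OF C] ch[OF AB(1)] r pAB(1)]
          dist_adjacent_right[OF C ch[OF C] ch[OF AB(2)] r pAB(2)] by auto
      have "\<phi> A \<noteq> \<phi> B" using \<phi> AB by (auto simp: Bij_def bij_betw_def inj_on_def)
      then have "\<delta> (\<phi> A) (\<phi> B) = ?r"
        using dist_same_panel[OF ch[OF C] ch[OF AB(1)] ch[OF AB(2)] r pAB] by simp
      then have "\<delta> C (\<phi> B) = ?w \<otimes> ?r \<otimes> ?r"
        using dist_adjacent_right_up[OF C ch[OF AB(1)] ch[OF AB(2)] r] eqs(1) wr
          gen_cancel_right[OF r w] by simp
      then have "?w \<otimes> ?r = ?w" using eqs(2) gen_cancel_right[OF r w] by simp
      then show False using wr by simp
    qed
    \<comment> \<open>For this neighbour only the step from \<open>C\<close> to \<open>X\<close>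
      affects the length, giving displacement \<open>s \<otimes> w\<close>; the case is
      contradictory.\<close>
    then obtain X where X: "X \<in> Ch" "\<delta> C X = s" "\<delta> C (\<phi> X) = ?w" using AB by blast
    have "\<delta> X C = s" using dist_sym_gen[OF C X(1,2) s] .
    then have "\<delta> X (\<phi> X) = s \<otimes> ?w"
      using dist_adjacent_up[OF C ch[OF X(1)] X(1) s] X(3) sw by simp
    then show ?thesis using max[OF X(1)] sw by simp
  qed
qed

theorem bounded_displacement_trivial:
  assumes "thick S Ch \<delta>" "purely_infinite W S"
    and aut: "\<phi> \<in> building_automorphisms W S Ch \<delta>"
    and bound: "\<And>C. C \<in> Ch \<Longrightarrow> len (\<delta> C (\<phi> C)) \<le> n"
    and D: "D \<in> Ch"
  shows "\<phi> D = D"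
proof -
  obtain \<sigma> where \<phi>: "\<phi> \<in> Bij Ch" and \<sigma>: "\<sigma> ` S = S"
    and eq: "\<And>C D. C \<in> Ch \<Longrightarrow> D \<in> Ch \<Longrightarrow> \<delta> (\<phi> C) (\<phi> D) = \<sigma> (\<delta> C D)"
    using aut by (auto simp: building_automorphisms_def cox_automorphisms_def)
  have ch: "\<phi> C \<in> Ch" if "C \<in> Ch" for C using Bij_imp_funcset[OF \<phi>] that by auto
  obtain C where C: "C \<in> Ch" and max: "\<And>D. D \<in> Ch \<Longrightarrow> len (\<delta> D (\<phi> D)) \<le> len (\<delta> C (\<phi> C))"
  proof -
    have "\<forall>C. C \<in> Ch \<longrightarrow> len (\<delta> C (\<phi> C)) < Suc n" using bound by (simp add: less_Suc_eq_le)
    from ex_has_greatest_nat[of "\<lambda>C. C \<in> Ch", OF D this] that show thesis by blast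
  qed
  let ?w = "\<delta> C (\<phi> C)"
  have w: "?w \<in> carrier W" using dist_closed C ch by blast
  have "?w = \<one>"
  proof (rule ccontr)
    assume "?w \<noteq> \<one>"
    \<comment> \<open>A left descent \<open>t\<close> of \<open>w\<close> lies outside
      \<open>K\<close>; its diagram component is the one that will be shown finite.\<close>
    then obtain t where t: "t \<in> S" "len ?w = len (t \<otimes> ?w) + 1"
      using exists_left_descent[of S ?w] w gens_generate by auto
    define K where "K = {s \<in> S. len ?w < len (s \<otimes> ?w)}"
    define T where "T = {s \<in> S. (diagram_edge W S)\<^sup>*\<^sup>* t s}"
    have comm: "s \<otimes> ?w = ?w \<otimes> \<sigma> s" if "s \<in> K" for s
      using max_displacement_commute[OF assms(1) \<phi> equalityD1[OF \<sigma>] eq C max, of s] that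
      unfolding K_def by simp
    have down: "len (s \<otimes> ?w) < len ?w" if "s \<in> S - K" for s
      using that len_gen_mult_cases[of s ?w] w unfolding K_def by auto
    have "K \<subseteq> S" "\<sigma> ` K \<subseteq> S" using \<sigma> unfolding K_def by auto
    from finite_index[OF w this comm down] obtain F where F: "finite F" "F \<subseteq> carrier W"
      "\<forall>x \<in> carrier W. \<exists>k \<in> generate W K. \<exists>f \<in> F. x = k \<otimes> f" by blast
    have "finite (generate W T)"
    proof (rule finite_component[OF _ t(1) _ _ F(1,2)])
      show "K \<subseteq> S - {t}" using t by (auto simp: K_def)
      show "T \<subseteq> S" by (auto simp: T_def)
      show "(diagram_edge W S)\<^sup>*\<^sup>* t s" if "s \<in> T" for s using that by (simp add: T_def)
      show "\<exists>k \<in> generate W K. \<exists>f \<in> F. x = k \<otimes> f" if "x \<in> carrier W" for x using F(3) that by blast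
    qed
    moreover have "T \<in> diagram_components W S"
    proof -
      have "T = {(s, t). s \<in> S \<and> t \<in> S \<and> (diagram_edge W S)\<^sup>*\<^sup>* s t} `` {t}"
        using t(1) by (auto simp: T_def)
      then show ?thesis unfolding diagram_components_def using quotientI[OF t(1)] by metis
    qed
    ultimately show False using assms(2) unfolding purely_infinite_def by blast
  qed
  \<comment> \<open>The greatest displacement is zero, so the arbitrary chamber \<open>D\<close> is
    fixed as well.\<close>
  then have "len (\<delta> D (\<phi> D)) = 0" using max[OF D] by simp
  then have "\<delta> D (\<phi> D) = \<one>" using len_eq_0[OF dist_closed[OF D ch[OF D]]] by simp
  then show ?thesis using dist_one[OF D ch[OF D]] by simp
qed

lemma automorphism_gallery_dist:
  assumes "\<phi> \<in> building_automorphisms W S Ch \<delta>" "C \<in> Ch" "D \<in> Ch"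
  shows "len (\<delta> (\<phi> C) (\<phi> D)) = len (\<delta> C D)"
proof -
  obtain \<sigma> where "\<sigma> \<in> cox_automorphisms W S" "\<delta> (\<phi> C) (\<phi> D) = \<sigma> (\<delta> C D)"
    using assms unfolding building_automorphisms_def by blast
  then show ?thesis using len_cox_automorphism dist_closed assms by simp
qed

end

section \<open>Central elements and bounded orbit representatives\<close>

theorem corollary3p5:
  fixes W :: "('w, 'm) monoid_scheme" and S :: "'w set"
    and Ch :: "'c set" and \<delta> :: "'c \<Rightarrow> 'c \<Rightarrow> 'w" and G :: "('c \<Rightarrow> 'c) set"
  assumes building: "building W S Ch \<delta>"
    and thick: "thick S Ch \<delta>"
    and infinite: "purely_infinite W S"
    and subgroup: "subgroup G (building_Aut W S Ch \<delta>)"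
    and bounded: "\<exists>R. orbit_representatives ((building_Aut W S Ch \<delta>)\<lparr>carrier := G\<rparr>) Ch R \<and>
           (\<exists>n. \<forall>C \<in> R. \<forall>D \<in> R. gallery_dist W S \<delta> C D \<le> n)"
  shows "center ((building_Aut W S Ch \<delta>)\<lparr>carrier := G\<rparr>) = {\<one>\<^bsub>building_Aut W S Ch \<delta>\<^esub>}"
proof -
  interpret building W S Ch \<delta> by (rule building)
  let ?A = "building_Aut W S Ch \<delta>"
  interpret A: group ?A by (rule group_building_Aut)
  have G: "\<phi> \<in> building_automorphisms W S Ch \<delta>" if "\<phi> \<in> G" for \<phi>
    using subgroup.mem_carrier[OF subgroup that] by (simp add: building_Aut_def)
  then have GB: "\<phi> \<in> Bij Ch" if "\<phi> \<in> G" for \<phi>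
    using that by (auto simp: building_automorphisms_def)
  have ch: "\<phi> C \<in> Ch" if "\<phi> \<in> G" "C \<in> Ch" for \<phi> C
    using Bij_imp_funcset[OF GB[OF that(1)]] that by auto
  have mult: "(\<phi> \<otimes>\<^bsub>?A\<^esub> \<psi>) C = \<phi> (\<psi> C)" if "\<phi> \<in> G" "\<psi> \<in> G" "C \<in> Ch" for \<phi> \<psi> C
    using that GB by (simp add: building_Aut_def BijGroup_def compose_def)
  obtain R n where R: "orbit_representatives (?A\<lparr>carrier := G\<rparr>) Ch R"
    and n: "\<And>C D. C \<in> R \<Longrightarrow> D \<in> R \<Longrightarrow> len (\<delta> C D) \<le> n"
    using bounded unfolding gallery_dist_def by blast
  have RCh: "R \<subseteq> Ch" using R by (simp add: orbit_representatives_def)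
  have rep: "\<exists>g \<in> G. g C \<in> R" if "C \<in> Ch" for C
  proof -
    have "orbit (?A\<lparr>carrier := G\<rparr>) (\<lambda>g. g) C \<in> orbits (?A\<lparr>carrier := G\<rparr>) Ch (\<lambda>g. g)"
      using that unfolding orbits_def by blast
    then obtain r where "r \<in> R" "r \<in> orbit (?A\<lparr>carrier := G\<rparr>) (\<lambda>g. g) C"
      using R unfolding orbit_representatives_def by blast
    then show ?thesis by (auto simp: orbit_def)
  qed
  have "z = \<one>\<^bsub>?A\<^esub>" if z: "z \<in> center (?A\<lparr>carrier := G\<rparr>)" for z
  proof -
    have zG: "z \<in> G" using z by (simp add: center_def)
    have comm: "z (g C) = g (z C)" if "g \<in> G" "C \<in> Ch" for g C
    proof -
      have "z \<otimes>\<^bsub>?A\<^esub> g = g \<otimes>\<^bsub>?A\<^esub> z" using z that by (simp add: center_def)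
      then show ?thesis using mult[OF zG that] mult[OF that(1) zG that(2)] by simp
    qed
    obtain C0 where "C0 \<in> Ch" using chambers_nonempty by blast
    then obtain r0 where r0: "r0 \<in> R" using rep by blast
    \<comment> \<open>The bound does not depend on \<open>C\<close>: go from the representative
      \<open>g C\<close> through \<open>r0\<close> and \<open>z r0\<close> to
      \<open>z (g C)\<close>, where both outer legs have length at most \<open>n\<close>.\<close>
    have "len (\<delta> C (z C)) \<le> n + (len (\<delta> r0 (z r0)) + n)" if C: "C \<in> Ch" for C
    proof -
      obtain g where g: "g \<in> G" "g C \<in> R" using rep[OF C] by blast
      let ?r = "g C"
      have rCh: "?r \<in> Ch" "r0 \<in> Ch" using g r0 RCh by auto
      \<comment> \<open>\<open>g\<close> preserves gallery distance and commutes with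
        \<open>z\<close>, so displacement is constant on orbits.\<close>
      have "len (\<delta> C (z C)) = len (\<delta> ?r (z ?r))"
        using automorphism_gallery_dist[OF G[OF g(1)] C ch[OF zG C]] comm[OF g(1) C] by simp
      also have "\<dots> \<le> len (\<delta> ?r r0) + (len (\<delta> r0 (z r0)) + len (\<delta> (z r0) (z ?r)))"
        using gallery_dist_triangle[OF rCh ch[OF zG rCh(1)]]
          gallery_dist_triangle[OF rCh(2) ch[OF zG rCh(2)] ch[OF zG rCh(1)]] by linarith
      also have "len (\<delta> (z r0) (z ?r)) = len (\<delta> r0 ?r)"
        using automorphism_gallery_dist[OF G[OF zG] rCh(2,1)] .
      finally show ?thesis using n[OF g(2) r0] n[OF r0 g(2)] by linarith
    qed
    then have "z C = C" if "C \<in> Ch" for C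
      using bounded_displacement_trivial[OF thick infinite G[OF zG]] that by blast
    \<comment> \<open>Automorphisms are extensional, so agreement on \<open>Ch\<close> already
      identifies \<open>z\<close> with the unit.\<close>
    then have "z = (\<lambda>C\<in>Ch. C)"
      using Bij_imp_extensional[OF GB[OF zG]] by (auto simp: extensional_def restrict_def)
    then show ?thesis by (simp add: building_Aut_def BijGroup_def)
  qed
  moreover have "\<one>\<^bsub>?A\<^esub> \<in> center (?A\<lparr>carrier := G\<rparr>)"
    using subgroup.one_closed[OF subgroup] subgroup.mem_carrier[OF subgroup]
    by (simp add: center_def)
  ultimately show ?thesis by blast
qed

end
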